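(* Let $\Delta=\{z\in\mathbb{C}:|z|<1\}$. There exists an extremal Beltrami differential $\mu\in Bel(\Delta)$ such that $[\mu]_Z$ contains infinitely many non-decreasable extremal dilatations and $[\mu]_Z$ contains infinitely many pseudo non-decreasable extremal dilatations.
   Context: $Bel(\Delta)$ is the Banach space of Beltrami differentials $\mu=\mu(z)\,d\bar z/dz$ on $\Delta$ with finite $L^\infty$-norm (i.e. complex-valued $\mu\in L^\infty(\Delta)$; elements are identified when equal a.e.). The norm is not required to be less than $1$. $Q(\Delta)$ is the Banach space of holomorphic functions (quadratic differentials) $\varphi$ on $\Delta$ with $\|\varphi\|=\iint_\Delta|\varphi(z)|\,dxdy<\infty$. Two elements $\mu,\nu\in Bel(\Delta)$ are infinitesimally Teichmüller equivalent if $\iint_\Delta(\mu-\nu)\varphi\,dxdy=0$ for all $\varphi\in Q(\Delta)$; $[\mu]_Z$ denotes the equivalence class of $\mu$, with norm $\|[\mu]_Z\|=\inf\{\|\nu\|_\infty:\nu\in[\mu]_Z\}$. A Beltrami differential (also called a dilatation) $\nu\in[\mu]_Z$ is extremal if $\|\nu\|_\infty=\|[\mu]_Z\|$. A Beltrami differential $\mu$ is non-decreasable in $[\mu]_Z$ if, for $\nu\in[\mu]_Z$, $|\nu(z)|\le|\mu(z)|$ a.e. in $\Delta$ implies $\nu=\mu$ (a.e.); otherwise it is decreasable. $\mu$ is strongly decreasable in $[\mu]_Z$ if there exists $\nu\in[\mu]_Z$ such that (A) $|\nu(z)|\le|\mu(z)|$ for almost all $z\in\Delta$, and (B) there exist a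 (nonempty) domain $G\subset\Delta$ and $\delta>0$ with $|\nu(z)|\le|\mu(z)|-\delta$ for almost all $z\in G$. Otherwise $\mu$ is weakly non-decreasable. $\mu$ is pseudo non-decreasable if it is weakly non-decreasable but not non-decreasable. *)

theory Defs
  imports "HOL-Probability.Essential_Supremum" "HOL-Complex_Analysis.Complex_Analysis"
begin

abbreviation Disk :: "complex set" (\<open>\<Delta>\<close>) where
  "\<Delta> \<equiv> ball 0 1"

abbreviation area :: "complex measure" where
  "area \<equiv> lebesgue_on \<Delta>"

text \<open>
  A Beltrami differential is represented by a measurable, essentially bounded function; its
  values outside the disk are irrelevant. Elements are not identified at this level: equality
  in \<open>Bel\<close> is the relation \<open>ae_eq\<close> below.
\<close>

definition Bel :: "(complex \<Rightarrow> complex) set" where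
  "Bel = {\<mu> \<in> borel_measurable area. esssup area (\<lambda>z. ereal (cmod (\<mu> z))) < \<infinity>}"

definition linf_norm :: "(complex \<Rightarrow> complex) \<Rightarrow> real" where
  "linf_norm \<mu> = real_of_ereal (esssup area (\<lambda>z. ereal (cmod (\<mu> z))))"

definition ae_eq :: "((complex \<Rightarrow> complex) \<times> (complex \<Rightarrow> complex)) set" where
  "ae_eq = {(\<mu>, \<nu>). \<mu> \<in> Bel \<and> \<nu> \<in> Bel \<and> (AE z in area. \<mu> z = \<nu> z)}"

definition Q :: "(complex \<Rightarrow> complex) set" where
  "Q = {\<phi>. \<phi> holomorphic_on \<Delta> \<and> integrable area (\<lambda>z. cmod (\<phi> z))}"

definition zclass :: "(complex \<Rightarrow> complex) \<Rightarrow> (complex \<Rightarrow> complex) set" where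
  "zclass \<mu> = {\<nu> \<in> Bel. \<forall>\<phi>\<in>Q. (LINT z|area. (\<mu> z - \<nu> z) * \<phi> z) = 0}"

definition zclass_norm :: "(complex \<Rightarrow> complex) \<Rightarrow> real" where
  "zclass_norm \<mu> = (INF \<nu>\<in>zclass \<mu>. linf_norm \<nu>)"

definition extremals :: "(complex \<Rightarrow> complex) \<Rightarrow> (complex \<Rightarrow> complex) set" where
  "extremals \<mu> = {\<nu> \<in> zclass \<mu>. linf_norm \<nu> = zclass_norm \<mu>}"

definition non_decreasable :: "(complex \<Rightarrow> complex) \<Rightarrow> bool" where
  "non_decreasable \<mu> \<longleftrightarrow>
     (\<forall>\<nu>\<in>zclass \<mu>. (AE z in area. cmod (\<nu> z) \<le> cmod (\<mu> z)) \<longrightarrow> (AE z in area. \<nu> z = \<mu> z))"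

definition strongly_decreasable :: "(complex \<Rightarrow> complex) \<Rightarrow> bool" where
  "strongly_decreasable \<mu> \<longleftrightarrow>
     (\<exists>\<nu>\<in>zclass \<mu>. (AE z in area. cmod (\<nu> z) \<le> cmod (\<mu> z)) \<and>
        (\<exists>G \<delta>. open G \<and> connected G \<and> G \<noteq> {} \<and> G \<subseteq> \<Delta> \<and> \<delta> > 0 \<and>
           (AE z in area. z \<in> G \<longrightarrow> cmod (\<nu> z) \<le> cmod (\<mu> z) - \<delta>)))"

definition weakly_non_decreasable :: "(complex \<Rightarrow> complex) \<Rightarrow> bool" where
  "weakly_non_decreasable \<mu> \<longleftrightarrow> \<not> strongly_decreasable \<mu>"

definition pseudo_non_decreasable :: "(complex \<Rightarrow> complex) \<Rightarrow> bool" where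
  "pseudo_non_decreasable \<mu> \<longleftrightarrow> weakly_non_decreasable \<mu> \<and> \<not> non_decreasable \<mu>"

end

theory Submission imports Defs begin

text \<open>
  Let \<open>\<phi>\<^sub>0 z = (1 - z)\<^sup>-\<^sup>2\<close>, which just fails to be integrable on the disk. The powers
  \<open>(1 - z)\<close> to the \<open>-2 + 1/n\<close> lie in \<open>Q\<close>, have norm of order \<open>n\<close> concentrating at the boundary
  point 1, and deviate in phase from \<open>\<phi>\<^sub>0\<close> by \<open>O(1/n)\<close>. Hence \<open>h |\<phi>\<^sub>0| / \<phi>\<^sub>0\<close> is non-decreasable
  for every bounded \<open>h \<ge> 0\<close>, and everything equivalent to a differential that agrees with
  \<open>|\<phi>\<^sub>0| / \<phi>\<^sub>0\<close> up to an error integrable against \<open>|\<phi>\<^sub>0|\<close> has norm at least 1.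

  By the mean value property, rearranging a radial density \<open>G\<close> in a disk \<open>|z| \<le> 1/2\<close> without changing
  its total mass does not change the class of \<open>G |1 - z|\<^sup>2 |\<phi>\<^sub>0| / \<phi>\<^sub>0 = G (1 - z)\<^sup>2\<close>. This gives the
  non-decreasable family. Likewise \<open>z\<close> times a radial function is equivalent to 0; adding
  multiples of it where the differential vanishes gives decreasable ones. If all of
  them vanish on an open dense set that is small enough near the point 1, none is strongly decreasable.
\<close>

subsection \<open>Integrals of holomorphic functions over sets of radii\<close>

lemma measurable_Complex [measurable]: "(\<lambda>(x, y). Complex x y) \<in> borel_measurable (lborel \<Otimes>\<^sub>M lborel)"
  unfolding Complex_eq by measurable

text \<open>Lebesgue measure is determined by its values on boxes, so it suffices to compare
  products of side lengths.\<close>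

lemma lborel_complex: "(lborel :: complex measure) = distr (lborel \<Otimes>\<^sub>M lborel) borel (\<lambda>(x, y). Complex x y)"
proof (rule lborel_eqI)
  fix l u :: complex
  assume le: "\<And>b. b \<in> Basis \<Longrightarrow> l \<bullet> b \<le> u \<bullet> b"
  have lu: "Re l \<le> Re u" "Im l \<le> Im u"
    using le[of 1] le[of \<i>] by (auto simp: Basis_complex_def)
  have eq: "(\<lambda>(x, y). Complex x y) -` box l u = {Re l<..<Re u} \<times> {Im l<..<Im u}"
    by (auto simp: box_def Basis_complex_def)
  have "emeasure (distr (lborel \<Otimes>\<^sub>M lborel) borel (\<lambda>(x, y). Complex x y)) (box l u)
      = emeasure (lborel \<Otimes>\<^sub>M lborel) ({Re l<..<Re u} \<times> {Im l<..<Im u})"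
    by (subst emeasure_distr) (simp_all add: eq space_pair_measure)
  also have "\<dots> = ennreal (Re u - Re l) * ennreal (Im u - Im l)"
    by (subst lborel.emeasure_pair_measure_Times) (use lu in auto)
  also have "\<dots> = (\<Prod>b\<in>Basis. (u - l) \<bullet> b)"
    using lu by (simp add: Basis_complex_def ennreal_mult)
  finally show "emeasure (distr (lborel \<Otimes>\<^sub>M lborel) borel (\<lambda>(x, y). Complex x y)) (box l u)
      = (\<Prod>b\<in>Basis. (u - l) \<bullet> b)" .
qed simp

text \<open>Both orders are provided because Green's formula integrates the x-derivative along
  horizontal chords first and the y-derivative along vertical ones.\<close>

lemma lborel_complex_integral:
  fixes f :: "complex \<Rightarrow> 'a::{banach, second_countable_topology}"
  assumes "integrable lborel f"
  shows "integral\<^sup>L lborel f = (\<integral>y. \<integral>x. f (Complex x y) \<partial>lborel \<partial>lborel)"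
    and "integral\<^sup>L lborel f = (\<integral>x. \<integral>y. f (Complex x y) \<partial>lborel \<partial>lborel)"
proof -
  have fm: "f \<in> borel_measurable borel" using assms by auto
  have "integrable (distr (lborel \<Otimes>\<^sub>M lborel) borel (\<lambda>(x, y). Complex x y)) f"
    using assms by (subst lborel_complex[symmetric])
  then have int: "integrable (lborel \<Otimes>\<^sub>M lborel) (\<lambda>p. f (case p of (x, y) \<Rightarrow> Complex x y))"
    by (subst (asm) integrable_distr_eq) (use fm in auto)
  then have int': "integrable (lborel \<Otimes>\<^sub>M lborel) (\<lambda>(x, y). f (Complex x y))"
    by (simp add: case_prod_unfold)
  have "integral\<^sup>L lborel f = (\<integral>p. f (case p of (x, y) \<Rightarrow> Complex x y) \<partial>(lborel \<Otimes>\<^sub>M lborel))"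
    by (subst lborel_complex, subst integral_distr) (use fm in auto)
  then have eq: "integral\<^sup>L lborel f = (\<integral>(x, y). f (Complex x y) \<partial>(lborel \<Otimes>\<^sub>M lborel))"
    by (simp add: case_prod_unfold)
  show "integral\<^sup>L lborel f = (\<integral>y. \<integral>x. f (Complex x y) \<partial>lborel \<partial>lborel)"
    unfolding eq by (rule lborel_pair.integral_snd[symmetric]) (fact int')
  show "integral\<^sup>L lborel f = (\<integral>x. \<integral>y. f (Complex x y) \<partial>lborel \<partial>lborel)"
    unfolding eq by (rule lborel_pair.integral_fst[symmetric]) (fact int')
qed

section \<open>Green's formula on a disk\<close>

lemma holomorphic_Complex_derivatives:
  assumes f: "f holomorphic_on S" and "open S" "Complex x y \<in> S"
  shows "((\<lambda>t. f (Complex t y)) has_vector_derivative deriv f (Complex x y)) (at x)"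
    and "((\<lambda>t. f (Complex x t)) has_vector_derivative \<i> * deriv f (Complex x y)) (at y)"
proof -
  have D: "(f has_field_derivative deriv f (Complex x y)) (at (Complex x y))"
    using assms holomorphic_derivI by blast
  have "((\<lambda>t. Complex t y) has_vector_derivative 1) (at x)"
    unfolding Complex_eq by (auto intro!: derivative_eq_intros)
  from field_vector_diff_chain_at[OF this, of f] D
  show "((\<lambda>t. f (Complex t y)) has_vector_derivative deriv f (Complex x y)) (at x)"
    by (simp add: o_def)
  have "((\<lambda>t. Complex x t) has_vector_derivative \<i>) (at y)"
    unfolding Complex_eq by (auto intro!: derivative_eq_intros)
  from field_vector_diff_chain_at[OF this, of f] D
  show "((\<lambda>t. f (Complex x t)) has_vector_derivative \<i> * deriv f (Complex x y)) (at y)"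
    by (simp add: o_def)
qed

lemma disk_chord:
  fixes x y r :: real assumes "\<bar>y\<bar> \<le> r"
  shows "x\<^sup>2 + y\<^sup>2 \<le> r\<^sup>2 \<longleftrightarrow> x \<in> {- sqrt (r\<^sup>2 - y\<^sup>2) .. sqrt (r\<^sup>2 - y\<^sup>2)}"
proof -
  have "x\<^sup>2 + y\<^sup>2 \<le> r\<^sup>2 \<longleftrightarrow> sqrt (x\<^sup>2) \<le> sqrt (r\<^sup>2 - y\<^sup>2)"
    unfolding real_sqrt_le_iff by linarith
  then show ?thesis by auto
qed

text \<open>Fundamental theorem of calculus along a chord of the disk, with \<open>G\<close>
  vanishing at both ends. The chord is empty when \<open>\<bar>y\<bar> > r\<close>.\<close>

lemma integral_chord:
  fixes G G' :: "real \<Rightarrow> complex"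
  assumes deriv: "\<And>x. x\<^sup>2 + y\<^sup>2 \<le> r\<^sup>2 \<Longrightarrow> (G has_vector_derivative G' x) (at x)"
    and cont: "continuous_on {x. x\<^sup>2 + y\<^sup>2 \<le> r\<^sup>2} G'"
    and zero: "\<And>x. x\<^sup>2 + y\<^sup>2 = r\<^sup>2 \<Longrightarrow> G x = 0" and r: "0 \<le> r"
  shows "(\<integral>x. indicator {x. x\<^sup>2 + y\<^sup>2 \<le> r\<^sup>2} x *\<^sub>R G' x \<partial>lborel) = 0"
proof (cases "\<bar>y\<bar> \<le> r")
  case True
  define s where "s = sqrt (r\<^sup>2 - y\<^sup>2)"
  have y: "y\<^sup>2 \<le> r\<^sup>2" using power_mono[OF True, of 2] by simp
  have s: "0 \<le> s" "s\<^sup>2 = r\<^sup>2 - y\<^sup>2" using y by (auto simp: s_def)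
  have set: "{x. x\<^sup>2 + y\<^sup>2 \<le> r\<^sup>2} = {-s..s}"
    unfolding disk_chord[OF True] s_def by auto
  have "(\<integral>x. indicator {-s..s} x *\<^sub>R G' x \<partial>lborel) = G s - G (-s)"
  proof (rule integral_FTC_Icc)
    fix x assume "-s \<le> x" "x \<le> s"
    then have "x \<in> {x. x\<^sup>2 + y\<^sup>2 \<le> r\<^sup>2}" unfolding set by simp
    then show "(G has_vector_derivative G' x) (at x within {-s..s})"
      using deriv[of x] has_vector_derivative_at_within by blast
  next
    show "-s \<le> s" using s by simp
    show "continuous_on {-s..s} G'" using cont unfolding set .
  qed
  also have "\<dots> = 0" using s zero[of s] zero[of "-s"] by simp
  finally show ?thesis by (simp only: set)
next
  case False
  then have "r\<^sup>2 < y\<^sup>2" using power_strict_mono[of r "\<bar>y\<bar>" 2] r by simp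
  then have "x\<^sup>2 + y\<^sup>2 > r\<^sup>2" for x using zero_le_power2[of x] by linarith
  then have "{x. x\<^sup>2 + y\<^sup>2 \<le> r\<^sup>2} = {}" by (auto simp: not_le)
  then show ?thesis by simp
qed

text \<open>Green's formula for \<open>(r\<^sup>2 - \<bar>z\<bar>\<^sup>2) f\<close>, which vanishes on the boundary circle and
  whose \<open>\<partial>/\<partial>x + \<i> \<partial>/\<partial>y\<close> is \<open>-2 z f\<close>.\<close>
lemma integral_cball_times_holomorphic:
  assumes f: "f holomorphic_on S" and S: "open S" "cball 0 r \<subseteq> S" and r: "0 \<le> r"
  shows "(\<integral>z. indicator (cball 0 r) z *\<^sub>R (z * f z) \<partial>lborel) = 0"
proof -
  \<comment> \<open>\<open>H1\<close> and \<open>H2\<close> are the partial derivatives of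
    \<open>(r\<^sup>2 - (cmod z)\<^sup>2) * f z\<close> in x and y.\<close>
  define H1 where "H1 z = of_real (- 2 * Re z) * f z + of_real (r\<^sup>2 - (cmod z)\<^sup>2) * deriv f z" for z
  define H2 where "H2 z = of_real (- 2 * Im z) * f z + of_real (r\<^sup>2 - (cmod z)\<^sup>2) * (\<i> * deriv f z)" for z
  have mem: "Complex x y \<in> cball 0 r \<longleftrightarrow> x\<^sup>2 + y\<^sup>2 \<le> r\<^sup>2" for x y
    using r by (simp add: cmod_def real_sqrt_le_iff')
  have contf: "continuous_on (cball 0 r) f" "continuous_on (cball 0 r) (deriv f)"
    using f S holomorphic_deriv holomorphic_on_imp_continuous_on continuous_on_subset by metis+
  have cont: "continuous_on (cball 0 r) H1" "continuous_on (cball 0 r) H2"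
    unfolding H1_def H2_def by (intro continuous_intros contf)+
  have int: "integrable lborel (\<lambda>z. indicator (cball 0 r) z *\<^sub>R H1 z)"
            "integrable lborel (\<lambda>z. indicator (cball 0 r) z *\<^sub>R H2 z)"
    by (intro borel_integrable_compact cont compact_cball)+
  have ind: "indicator (cball 0 r) (Complex x y) = (indicator {x. x\<^sup>2 + y\<^sup>2 \<le> r\<^sup>2} x :: real)"
            "indicator (cball 0 r) (Complex x y) = (indicator {y. y\<^sup>2 + x\<^sup>2 \<le> r\<^sup>2} y :: real)" for x y
    using mem[of x y] by (auto simp: indicator_def add.commute)
  have inS: "Complex x y \<in> S" if "x\<^sup>2 + y\<^sup>2 \<le> r\<^sup>2" for x y
    using that mem S by auto
  have z1: "(\<integral>x. indicator {x. x\<^sup>2 + y\<^sup>2 \<le> r\<^sup>2} x *\<^sub>R H1 (Complex x y) \<partial>lborel) = 0" for y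
  proof (rule integral_chord[where G = "\<lambda>x. of_real (r\<^sup>2 - x\<^sup>2 - y\<^sup>2) * f (Complex x y)"])
    fix x assume "x\<^sup>2 + y\<^sup>2 \<le> r\<^sup>2"
    then have D: "((\<lambda>x. f (Complex x y)) has_vector_derivative deriv f (Complex x y)) (at x)"
      by (intro holomorphic_Complex_derivatives(1)[OF f S(1)] inS)
    have "((\<lambda>x. complex_of_real (r\<^sup>2 - x\<^sup>2 - y\<^sup>2)) has_vector_derivative of_real (- 2 * x)) (at x)"
      by (intro has_vector_derivative_of_real) (auto intro!: derivative_eq_intros)
    from has_vector_derivative_mult[OF this D]
    show "((\<lambda>x. of_real (r\<^sup>2 - x\<^sup>2 - y\<^sup>2) * f (Complex x y)) has_vector_derivative H1 (Complex x y)) (at x)"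
      by (simp add: H1_def cmod_power2 diff_diff_eq add.commute)
  next
    have "continuous_on {x. x\<^sup>2 + y\<^sup>2 \<le> r\<^sup>2} (\<lambda>x. Complex x y)"
      unfolding Complex_eq by (intro continuous_intros)
    then show "continuous_on {x. x\<^sup>2 + y\<^sup>2 \<le> r\<^sup>2} (\<lambda>x. H1 (Complex x y))"
      by (rule continuous_on_compose2[OF cont(1)]) (use mem in auto)
  qed (use r in \<open>simp_all add: diff_diff_eq\<close>)
  have z2: "(\<integral>y. indicator {y. y\<^sup>2 + x\<^sup>2 \<le> r\<^sup>2} y *\<^sub>R H2 (Complex x y) \<partial>lborel) = 0" for x
  proof (rule integral_chord[where G = "\<lambda>y. of_real (r\<^sup>2 - x\<^sup>2 - y\<^sup>2) * f (Complex x y)"])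
    fix y assume "y\<^sup>2 + x\<^sup>2 \<le> r\<^sup>2"
    then have D: "((\<lambda>y. f (Complex x y)) has_vector_derivative \<i> * deriv f (Complex x y)) (at y)"
      by (intro holomorphic_Complex_derivatives(2)[OF f S(1)] inS) (simp add: add.commute)
    have "((\<lambda>y. complex_of_real (r\<^sup>2 - x\<^sup>2 - y\<^sup>2)) has_vector_derivative of_real (- 2 * y)) (at y)"
      by (intro has_vector_derivative_of_real) (auto intro!: derivative_eq_intros)
    from has_vector_derivative_mult[OF this D]
    show "((\<lambda>y. of_real (r\<^sup>2 - x\<^sup>2 - y\<^sup>2) * f (Complex x y)) has_vector_derivative H2 (Complex x y)) (at y)"
      by (simp add: H2_def cmod_power2 diff_diff_eq add.commute)
  next
    have "continuous_on {y. y\<^sup>2 + x\<^sup>2 \<le> r\<^sup>2} (\<lambda>y. Complex x y)"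
      unfolding Complex_eq by (intro continuous_intros)
    then show "continuous_on {y. y\<^sup>2 + x\<^sup>2 \<le> r\<^sup>2} (\<lambda>y. H2 (Complex x y))"
      by (rule continuous_on_compose2[OF cont(2)]) (use mem in \<open>auto simp: add.commute\<close>)
  qed (use r in \<open>simp_all add: diff_diff_eq add.commute\<close>)
  have "(\<integral>z. indicator (cball 0 r) z *\<^sub>R H1 z \<partial>lborel) = 0"
    by (simp add: lborel_complex_integral(1)[OF int(1)] ind(1) z1 del: indicator_simps)
  moreover have "(\<integral>z. indicator (cball 0 r) z *\<^sub>R H2 z \<partial>lborel) = 0"
    by (simp add: lborel_complex_integral(2)[OF int(2)] ind(2) z2 del: indicator_simps)
  ultimately have "(\<integral>z. indicator (cball 0 r) z *\<^sub>R H1 z + \<i> * (indicator (cball 0 r) z *\<^sub>R H2 z) \<partial>lborel) = 0"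
    by (subst Bochner_Integration.integral_add) (use int in \<open>auto simp del: mult_scaleR_right\<close>)
  also have "(\<lambda>z. indicator (cball 0 r) z *\<^sub>R H1 z + \<i> * (indicator (cball 0 r) z *\<^sub>R H2 z))
    = (\<lambda>z. - 2 * (indicator (cball 0 r) z *\<^sub>R (z * f z)))"
  proof
    fix z :: complex
    have "H1 z + \<i> * H2 z = - 2 * ((of_real (Re z) + \<i> * of_real (Im z)) * f z)"
    proof -
      \<comment> \<open>The terms with \<open>deriv f\<close> cancel because 1 + i * i = 0, which is
        the Cauchy-Riemann equation; only the derivative of the cutoff factor survives.\<close>
      have "a * F + K * D + I * (b * F + K * (I * D)) = (a + I * b) * F + K * D * (1 + I * I)"
        for a b F K D I :: complex by (simp add: algebra_simps)
      from this[of "of_real (- 2 * Re z)" "f z" "of_real (r\<^sup>2 - (cmod z)\<^sup>2)" "deriv f z" \<i> "of_real (- 2 * Im z)"]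
      show ?thesis unfolding H1_def H2_def by (simp add: algebra_simps)
    qed
    also have "\<dots> = - 2 * (z * f z)" by (simp flip: complex_eq)
    finally show "indicator (cball 0 r) z *\<^sub>R H1 z + \<i> * (indicator (cball 0 r) z *\<^sub>R H2 z)
      = - 2 * (indicator (cball 0 r) z *\<^sub>R (z * f z))"
      by (simp add: indicator_def)
  qed
  finally have "(\<integral>z. - 2 * (indicator (cball 0 r) z *\<^sub>R (z * f z)) \<partial>lborel) = 0" .
  then show ?thesis by (simp only: integral_mult_right_zero) simp
qed

section \<open>From disks to arbitrary shells\<close>

lemma lebesgue_on_integral_eq_lborel:
  fixes f :: "'a::euclidean_space \<Rightarrow> 'b::{banach, second_countable_topology}"
  assumes f: "continuous_on S f" "compact S" "S \<subseteq> T" "T \<in> sets lebesgue"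
  shows "integrable (lebesgue_on T) (\<lambda>z. indicator S z *\<^sub>R f z)"
    and "(\<integral>z. indicator S z *\<^sub>R f z \<partial>lebesgue_on T) = (\<integral>z. indicator S z *\<^sub>R f z \<partial>lborel)"
proof -
  have int: "integrable lborel (\<lambda>z. indicator S z *\<^sub>R f z)"
    by (intro borel_integrable_compact f)
  then have m: "(\<lambda>z. indicator S z *\<^sub>R f z) \<in> borel_measurable lborel" by auto
  have eq: "(\<lambda>z. indicator T z *\<^sub>R indicator S z *\<^sub>R f z) = (\<lambda>z. indicator S z *\<^sub>R f z)"
    using f(3) by (auto simp: indicator_def fun_eq_iff)
  have T: "T \<inter> space lebesgue \<in> sets lebesgue" using f(4) by simp
  show "integrable (lebesgue_on T) (\<lambda>z. indicator S z *\<^sub>R f z)"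
    using int m by (simp add: integrable_restrict_space[OF T] eq integrable_completion del: scaleR_scaleR)
  show "(\<integral>z. indicator S z *\<^sub>R f z \<partial>lebesgue_on T) = (\<integral>z. indicator S z *\<^sub>R f z \<partial>lborel)"
    using m by (simp add: integral_restrict_space[OF T] eq integral_completion del: scaleR_scaleR)
qed

definition shell :: "real set \<Rightarrow> complex set" where
  "shell S = {z \<in> \<Delta>. cmod z \<in> S}"

lemma shell_borel: "S \<in> sets borel \<Longrightarrow> shell S \<in> sets borel"
proof -
  assume S: "S \<in> sets borel"
  have "cmod -` S \<in> sets borel"
    by (rule measurable_sets_borel[OF _ S]) simp
  then have "\<Delta> \<inter> cmod -` S \<in> sets borel" by (intro sets.Int) simp_all
  moreover have "shell S = \<Delta> \<inter> cmod -` S" by (auto simp: shell_def)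
  ultimately show "shell S \<in> sets borel" by simp
qed

lemma sets_area: "S \<in> sets lebesgue \<Longrightarrow> S \<subseteq> \<Delta> \<Longrightarrow> S \<in> sets area"
  by (subst sets_restrict_space_iff) auto

lemma shell_measurable: "S \<in> sets borel \<Longrightarrow> shell S \<in> sets area"
  by (intro sets_area sets_completionI_sets) (auto intro: shell_borel simp: shell_def)

lemma emeasure_area_finite: "emeasure area S \<noteq> \<infinity>"
proof -
  have "emeasure area S \<le> emeasure area (space area)" by (rule emeasure_space)
  also have "\<dots> = emeasure lborel \<Delta>" by (simp add: emeasure_restrict_space)
  also have "\<dots> < \<infinity>" using emeasure_lborel_ball_finite by simp
  finally show ?thesis by simp
qed

lemma finite_measure_area: "finite_measure area"
  by (rule finite_measureI) (rule emeasure_area_finite)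

lemma integrable_area_bounded:
  fixes f :: "complex \<Rightarrow> 'a::{banach, second_countable_topology}"
  assumes "f \<in> borel_measurable area" "\<And>z. z \<in> \<Delta> \<Longrightarrow> norm (f z) \<le> B"
  shows "integrable area f"
  using assms by (intro finite_measure.integrable_const_bound[OF finite_measure_area]) (auto intro!: AE_I2)

lemma holomorphic_measurable: "f holomorphic_on \<Delta> \<Longrightarrow> f \<in> borel_measurable area"
  by (intro continuous_imp_measurable_on_sets_lebesgue holomorphic_on_imp_continuous_on) auto

text \<open>By Dynkin's lemma, from disks to all sets of radii.\<close>
lemma integral_shell_times_holomorphic:
  assumes f: "f holomorphic_on \<Delta>" and S: "S \<in> sets borel" "S \<subseteq> {..a}" and a: "0 \<le> a" "a < 1"
  shows "(\<integral>z. indicator (shell S) z *\<^sub>R (z * f z) \<partial>area) = 0"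
proof -
  have contf: "continuous_on (cball 0 a) f"
    using f a by (intro continuous_on_subset[OF holomorphic_on_imp_continuous_on[OF f]]) auto
  have fm[measurable]: "f \<in> borel_measurable area" by (rule holomorphic_measurable[OF f])
  have mz [measurable]: "(\<lambda>z. z) \<in> borel_measurable area"
    by (intro holomorphic_measurable holomorphic_on_ident)
  have "compact ((\<lambda>z. z * f z) ` cball 0 a)"
    by (intro compact_continuous_image continuous_intros contf compact_cball)
  from compact_imp_bounded[OF this] obtain B where "\<forall>x\<in>(\<lambda>z. z * f z) ` cball 0 a. norm x \<le> B"
    unfolding bounded_iff by (elim exE)
  then have B: "\<And>z. z \<in> cball 0 a \<Longrightarrow> cmod (z * f z) \<le> B" by simp
  have B0: "0 \<le> B" using order_trans[OF norm_ge_zero B[of 0]] a by simp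
  \<comment> \<open>Intersecting with \<open>{..a}\<close> keeps every set of the induction,
    complements included, in a compact disk where \<open>f\<close> is bounded; on the whole disk
    \<open>f\<close> may fail to be integrable.\<close>
  have int: "integrable area (\<lambda>z. indicator (shell (S \<inter> {..a})) z *\<^sub>R (z * f z))"
    if "S \<in> sets borel" for S
  proof (rule integrable_area_bounded)
    have [measurable]: "shell (S \<inter> {..a}) \<in> sets area"
      using that by (intro shell_measurable sets.Int) simp_all
    show "(\<lambda>z. indicator (shell (S \<inter> {..a})) z *\<^sub>R (z * f z)) \<in> borel_measurable area" by measurable
    show "cmod (indicator (shell (S \<inter> {..a})) z *\<^sub>R (z * f z)) \<le> B" for z
      using B[of z] B0 by (auto simp: indicator_def shell_def)
  qed
  have disk: "(\<integral>z. indicator (shell ({..b} \<inter> {..a})) z *\<^sub>R (z * f z) \<partial>area) = 0" for b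
  proof (cases "0 \<le> b")
    case True
    define c where "c = min a b"
    have c: "0 \<le> c" "c < 1" using a True by (auto simp: c_def)
    have eq: "shell ({..b} \<inter> {..a}) = cball 0 c"
      using c a by (auto simp: shell_def c_def)
    have "(\<integral>z. indicator (cball 0 c) z *\<^sub>R (z * f z) \<partial>area) = (\<integral>z. indicator (cball 0 c) z *\<^sub>R (z * f z) \<partial>lborel)"
      using c a by (intro lebesgue_on_integral_eq_lborel continuous_intros continuous_on_subset[OF contf])
        (auto simp: c_def)
    also have "\<dots> = 0" using c by (intro integral_cball_times_holomorphic[OF f]) auto
    finally show ?thesis by (simp only: eq)
  next
    case False
    have "shell ({..b} \<inter> {..a}) = {}"
      using False by (auto simp: shell_def intro: order_trans[OF norm_ge_zero])
    then show ?thesis by simp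
  qed
  have borel: "sigma_sets UNIV (range atMost) = sets (borel :: real measure)"
    by (subst borel_eq_atMost) simp
  have "Int_stable (range (atMost :: real \<Rightarrow> _))"
    by (auto simp: Int_stable_def)
  moreover have "range atMost \<subseteq> Pow (UNIV :: real set)" by simp
  moreover have "S \<in> sigma_sets UNIV (range atMost)" unfolding borel by (rule S(1))
  ultimately have "(\<integral>z. indicator (shell (S \<inter> {..a})) z *\<^sub>R (z * f z) \<partial>area) = 0"
  proof (induction S rule: sigma_sets_induct_disjoint)
    case (basic A) then show ?case using disk by auto
  next
    case empty then show ?case by (simp add: shell_def)
  next
    case (compl A)
    then have A: "A \<in> sets borel" unfolding borel by auto
    \<comment> \<open>The complement is taken inside the disk of radius \<open>a\<close>, whose
      integral is already known to be 0.\<close>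
    have "(\<lambda>z. indicator (shell ((UNIV - A) \<inter> {..a})) z *\<^sub>R (z * f z)) =
      (\<lambda>z. indicator (shell ({..a} \<inter> {..a})) z *\<^sub>R (z * f z) - indicator (shell (A \<inter> {..a})) z *\<^sub>R (z * f z))"
      by (auto simp: fun_eq_iff indicator_def shell_def)
    then show ?case using int[OF A] int[of "{..a}"] disk[of a] compl by simp
  next
    case (union A)
    then have A: "A i \<in> sets borel" for i unfolding borel by auto
    have U: "shell (\<Union> (range A) \<inter> {..a}) = (\<Union>i. shell (A i \<inter> {..a}))" by (auto simp: shell_def)
    have "(\<integral>z\<in>(\<Union>i. shell (A i \<inter> {..a})). (z * f z) \<partial>area) = (\<Sum>i. \<integral>z\<in>shell (A i \<inter> {..a}). (z * f z) \<partial>area)"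
    proof (rule lebesgue_integral_countable_add)
      show "shell (A i \<inter> {..a}) \<in> sets area" for i by (intro shell_measurable sets.Int A) simp
      show "shell (A i \<inter> {..a}) \<inter> shell (A j \<inter> {..a}) = {}" if "i \<noteq> j" for i j
        proof -
        have "A i \<inter> A j = {}" using union(1) that by (simp add: disjoint_family_on_def)
        then show ?thesis by (auto simp: shell_def)
      qed
      show "set_integrable area (\<Union>i. shell (A i \<inter> {..a})) (\<lambda>z. z * f z)"
        unfolding set_integrable_def U[symmetric] using A by (intro int sets.countable_UN) auto
    qed
    also have "\<dots> = 0" using union(3) by (simp add: set_lebesgue_integral_def)
    finally show ?case unfolding U set_lebesgue_integral_def by simp
  qed
  moreover have "S \<inter> {..a} = S" using S by auto
  ultimately show ?thesis by simp
qed

text \<open>Mean value property over radial sets: in \<open>f z = f 0 + z * g z\<close> the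
  difference quotient \<open>g\<close> extends holomorphically across 0, so the second term
  integrates to 0.\<close>

lemma integral_shell_holomorphic:
  assumes f: "f holomorphic_on \<Delta>" and S: "S \<in> sets borel" "S \<subseteq> {..a}" and a: "0 \<le> a" "a < 1"
  shows "integrable area (\<lambda>z. indicator (shell S) z *\<^sub>R f z)"
    and "(\<integral>z. indicator (shell S) z *\<^sub>R f z \<partial>area) = measure area (shell S) *\<^sub>R f 0"
proof -
  have [measurable]: "shell S \<in> sets area" by (rule shell_measurable[OF S(1)])
  have sub: "shell S \<inter> \<Delta> = shell S" by (auto simp: shell_def)
  have intf: "integrable area (\<lambda>z. indicator (shell S) z *\<^sub>R f z)" if f: "f holomorphic_on \<Delta>" for f
  proof -
    have fm[measurable]: "f \<in> borel_measurable area" by (rule holomorphic_measurable[OF f])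
    have contf: "continuous_on (cball 0 a) f"
      using f a by (intro continuous_on_subset[OF holomorphic_on_imp_continuous_on[OF f]]) auto
    have "compact (f ` cball 0 a)"
      by (intro compact_continuous_image continuous_intros contf compact_cball)
    from compact_imp_bounded[OF this] obtain B where "\<forall>x\<in>f ` cball 0 a. norm x \<le> B"
    unfolding bounded_iff by (elim exE)
  then have B: "\<And>z. z \<in> cball 0 a \<Longrightarrow> cmod (f z) \<le> B" by simp
    have B0: "0 \<le> B" using order_trans[OF norm_ge_zero B[of 0]] a by simp
    show ?thesis
    proof (rule integrable_area_bounded)
      show "(\<lambda>z. indicator (shell S) z *\<^sub>R f z) \<in> borel_measurable area" by measurable
      show "cmod (indicator (shell S) z *\<^sub>R f z) \<le> B" for z
        using B[of z] B0 S by (auto simp: indicator_def shell_def)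
    qed
  qed
  show "integrable area (\<lambda>z. indicator (shell S) z *\<^sub>R f z)" by (rule intf[OF f])
  define g where "g = (\<lambda>z. if z = 0 then deriv f 0 else (f z - f 0) / (z - 0))"
  have g: "g holomorphic_on \<Delta>" unfolding g_def by (rule pole_lemma_open[OF f]) simp
  have fg: "f z = f 0 + z * g z" for z by (simp add: g_def)
  have "(\<integral>z. indicator (shell S) z *\<^sub>R f z \<partial>area)
     = (\<integral>z. indicator (shell S) z *\<^sub>R f 0 + indicator (shell S) z *\<^sub>R (z * g z) \<partial>area)"
    by (subst fg) (simp add: scaleR_right_distrib)
  also have "\<dots> = (\<integral>z. indicator (shell S) z *\<^sub>R f 0 \<partial>area) + (\<integral>z. indicator (shell S) z *\<^sub>R (z * g z) \<partial>area)"
    by (intro Bochner_Integration.integral_add intf) (auto intro!: holomorphic_intros g)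
  also have "(\<integral>z. indicator (shell S) z *\<^sub>R (z * g z) \<partial>area) = 0"
    by (rule integral_shell_times_holomorphic[OF g S a])
  also have "(\<integral>z. indicator (shell S) z *\<^sub>R f 0 \<partial>area) = measure area (shell S) *\<^sub>R f 0"
    using emeasure_area_finite[of "shell S"]
    by (subst integral_scaleR_left) (auto intro!: integrable_real_indicator simp: less_top sub)
  finally show "(\<integral>z. indicator (shell S) z *\<^sub>R f z \<partial>area) = measure area (shell S) *\<^sub>R f 0" by simp
qed

subsection \<open>The quadratic differentials approximating \<open>(1 - z)\<^sup>-\<^sup>2\<close>\<close>

text \<open>With \<open>\<phi>\<^sub>0 z = (1 - z)\<^sup>-\<^sup>2\<close>, \<open>weight\<close> is \<open>|\<phi>\<^sub>0|\<close>, \<open>direction\<close> is \<open>|\<phi>\<^sub>0| / \<phi>\<^sub>0\<close>, and \<open>qd n\<close> tends to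
  \<open>\<phi>\<^sub>0\<close>.\<close>

definition weight :: "complex \<Rightarrow> real" where
  "weight z = 1 / (cmod (1 - z))\<^sup>2"

definition direction :: "complex \<Rightarrow> complex" where
  "direction z = (1 - z)\<^sup>2 / of_real ((cmod (1 - z))\<^sup>2)"

definition qd :: "nat \<Rightarrow> complex \<Rightarrow> complex" where
  "qd n z = exp (of_real (1 / real (Suc n) - 2) * Ln (1 - z))"

lemma disk_one_minus:
  assumes "z \<in> \<Delta>"
  shows "0 < Re (1 - z)" "1 - z \<noteq> 0" "0 < cmod (1 - z)" "cmod (1 - z) < 2"
proof -
  have "Re z \<le> cmod z" by (rule complex_Re_le_cmod)
  with assms show R: "0 < Re (1 - z)" by simp
  then show "1 - z \<noteq> 0" by (metis less_irrefl zero_complex.simps(1))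
  then show "0 < cmod (1 - z)" by simp
  have "cmod (1 - z) \<le> cmod 1 + cmod z" by (rule norm_triangle_ineq4)
  with assms show "cmod (1 - z) < 2" by simp
qed

lemma qd_holomorphic: "qd n holomorphic_on \<Delta>"
proof -
  have "1 - z \<notin> \<real>\<^sub>\<le>\<^sub>0" if "z \<in> \<Delta>" for z
    using disk_one_minus(1)[OF that] complex_nonpos_Reals_iff[of "1 - z"] by linarith
  then show ?thesis unfolding qd_def by (intro holomorphic_intros)
qed

lemma qd_measurable [measurable]: "qd n \<in> borel_measurable area"
  by (rule holomorphic_measurable[OF qd_holomorphic])

lemma norm_qd:
  assumes "z \<in> \<Delta>"
  shows "cmod (qd n z) = cmod (1 - z) powr (1 / real (Suc n) - 2)"
  using disk_one_minus[OF assms] by (simp add: qd_def powr_def)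

text \<open>The extra factor \<open>cmod (1 - z) powr (1 / real (Suc n))\<close> is at most 2 on the
  disk. The bound is uniform in \<open>n\<close>, so an error integrable against
  \<open>weight\<close> has bounded pairings with all \<open>qd n\<close>.\<close>

lemma norm_qd_le:
  assumes "z \<in> \<Delta>" shows "cmod (qd n z) \<le> 2 * weight z"
proof -
  note w = disk_one_minus[OF assms]
  have "cmod (qd n z) = cmod (1 - z) powr (1 / real (Suc n)) / cmod (1 - z) powr 2"
    unfolding norm_qd[OF assms] powr_diff ..
  also have "cmod (1 - z) powr 2 = (cmod (1 - z))\<^sup>2" using w by (simp add: powr_numeral)
  also have "cmod (1 - z) powr (1 / real (Suc n)) \<le> 2 powr (1 / real (Suc n))"
    using w by (intro powr_mono2) auto
  also have "2 powr (1 / real (Suc n)) \<le> 2 powr (1::real)" by (intro powr_mono) auto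
  finally show ?thesis by (simp add: weight_def divide_right_mono)
qed

text \<open>With \<open>L = Ln (1 - z)\<close> the phases are \<open>2 * Im L\<close> for
  \<open>direction\<close> and \<open>(1 / real (Suc n) - 2) * Im L\<close> for \<open>qd n\<close>;
  all but \<open>Im L / real (Suc n)\<close> cancels.\<close>

lemma direction_qd:
  assumes "z \<in> \<Delta>"
  shows "direction z * qd n z = of_real (cmod (qd n z)) * cis (Im (Ln (1 - z)) / real (Suc n))"
proof -
  define L where "L = Ln (1 - z)"
  have w: "1 - z = exp L" using disk_one_minus[OF assms] by (simp add: L_def)
  have d: "direction z = exp (2 * L - of_real (2 * Re L))"
    unfolding exp_diff exp_of_real by (simp add: direction_def w flip: exp_double of_real_power)
  have "2 * L - of_real (2 * Re L) + of_real (1 / real (Suc n) - 2) * L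
    = of_real ((1 / real (Suc n) - 2) * Re L) + \<i> * of_real (Im L / real (Suc n))"
    by (simp add: complex_eq_iff algebra_simps)
  then have "direction z * qd n z = exp (of_real ((1 / real (Suc n) - 2) * Re L)) * cis (Im L / real (Suc n))"
    unfolding d qd_def L_def[symmetric] cis_conv_exp exp_add[symmetric] by simp
  moreover have "cmod (qd n z) = exp ((1 / real (Suc n) - 2) * Re L)"
    by (simp add: qd_def L_def)
  ultimately show ?thesis unfolding exp_of_real by (simp only: L_def)
qed

lemma norm_direction: "z \<in> \<Delta> \<Longrightarrow> cmod (direction z) = 1"
  using disk_one_minus[of z] by (simp add: direction_def norm_divide norm_power)

lemma direction_measurable [measurable]: "direction \<in> borel_measurable area"
proof -
  have "continuous_on \<Delta> direction"
    unfolding direction_def by (intro continuous_intros) (use disk_one_minus in fastforce)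
  then show ?thesis by (intro continuous_imp_measurable_on_sets_lebesgue) auto
qed

lemma weight_measurable [measurable]: "weight \<in> borel_measurable area"
proof -
  have "continuous_on \<Delta> weight"
    unfolding weight_def by (intro continuous_intros) (use disk_one_minus in fastforce)
  then show ?thesis by (intro continuous_imp_measurable_on_sets_lebesgue) auto
qed

text \<open>Since \<open>1 - z\<close> lies in the right half plane, the remaining phase
  \<open>t\<close> is at most \<open>2 / real (Suc n)\<close> in absolute value, pi / 2 being
  rounded up to 2; then \<open>1 - cos t\<close> is at most half the square of that.\<close>

lemma Re_direction_qd:
  assumes "z \<in> \<Delta>"
  shows "(1 - 2 / (real (Suc n))\<^sup>2) * cmod (qd n z) \<le> Re (direction z * qd n z)"
proof -
  define t where "t = Im (Ln (1 - z)) / real (Suc n)"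
  have "\<bar>Im (Ln (1 - z))\<bar> < pi / 2" using disk_one_minus[OF assms] Re_Ln_pos_lt by blast
  then have "\<bar>Im (Ln (1 - z))\<bar> \<le> 2" using pi_less_4 by linarith
  then have "\<bar>t\<bar> \<le> 2 / real (Suc n)" by (simp add: t_def abs_divide divide_right_mono)
  then have t: "t\<^sup>2 \<le> (2 / real (Suc n))\<^sup>2"
    using power_mono[OF _ abs_ge_zero, of t "2 / real (Suc n)" 2] by simp
  have "1 - cos t = 2 * (sin (t / 2))\<^sup>2" using cos_double_sin[of "t / 2"] by simp
  also have "(sin (t / 2))\<^sup>2 \<le> (t / 2)\<^sup>2" using abs_sin_x_le_abs_x[of "t / 2"]
    by (simp only: abs_le_square_iff)
  also have "2 * (t / 2)\<^sup>2 = t\<^sup>2 / 2" by (simp add: power2_eq_square)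
  also have "\<dots> \<le> (2 / real (Suc n))\<^sup>2 / 2" using t by simp
  also have "\<dots> = 2 / (real (Suc n))\<^sup>2" by (simp add: power_divide)
  finally have c: "1 - 2 / (real (Suc n))\<^sup>2 \<le> cos t" by simp
  have R: "Re (direction z * qd n z) = cmod (qd n z) * cos t"
    unfolding direction_qd[OF assms] t_def by simp
  show "(1 - 2 / (real (Suc n))\<^sup>2) * cmod (qd n z) \<le> Re (direction z * qd n z)"
    unfolding R using mult_right_mono[OF c, of "cmod (qd n z)"] by (simp add: mult.commute)
qed

lemma qd_tendsto:
  assumes "z \<in> \<Delta>"
  shows "(\<lambda>n. qd n z) \<longlonglongrightarrow> 1 / (1 - z)\<^sup>2"
proof -
  have "(\<lambda>n. 1 / real (Suc n) - 2) \<longlonglongrightarrow> 0 - 2"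
    by (intro tendsto_intros LIMSEQ_Suc lim_inverse_n' )
  then have "(\<lambda>n. qd n z) \<longlonglongrightarrow> exp (of_real (0 - 2) * Ln (1 - z))"
    unfolding qd_def by (intro tendsto_exp tendsto_mult tendsto_of_real tendsto_const)
  also have "exp (of_real (0 - 2) * Ln (1 - z)) = inverse (exp (Ln (1 - z)) ^ 2)"
    by (simp add: exp_minus flip: exp_double)
  also have "exp (Ln (1 - z)) = 1 - z" using disk_one_minus[OF assms] by simp
  finally show ?thesis by (simp add: divide_inverse)
qed

section \<open>Area estimates near the point 1\<close>

lemma emeasure_area: "S \<in> sets borel \<Longrightarrow> S \<subseteq> \<Delta> \<Longrightarrow> emeasure area S = emeasure lborel S"
  by (simp add: emeasure_restrict_space)

lemma emeasure_ball_complex: "0 \<le> r \<Longrightarrow> emeasure lborel (ball (c::complex) r) = ennreal (pi * r\<^sup>2)"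
  by (simp add: emeasure_ball unit_ball_vol_2)

text \<open>Union bound: the integrand is dominated by the sum of \<open>c i\<close> times the
  indicators of the pieces. Overlaps are allowed, as is needed for the annuli around all rational
  radii.\<close>

lemma nn_integral_UN_le:
  fixes f :: "'a \<Rightarrow> real"
  assumes A: "\<And>i::nat. A i \<in> sets M" and f: "\<And>i z. z \<in> A i \<Longrightarrow> f z \<le> c i"
    and a: "\<And>i. emeasure M (A i) \<le> ennreal (a i)" and c: "\<And>i. 0 \<le> c i" and s: "(\<lambda>i. c i * a i) sums s"
    and a0: "\<And>i. 0 \<le> a i"
  shows "(\<integral>\<^sup>+z. ennreal (f z) * indicator (\<Union>i. A i) z \<partial>M) \<le> ennreal s"
proof -
  have "(\<integral>\<^sup>+z. ennreal (f z) * indicator (\<Union>i. A i) z \<partial>M) \<le> (\<integral>\<^sup>+z. (\<Sum>i. ennreal (c i) * indicator (A i) z) \<partial>M)"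
  proof (intro nn_integral_mono)
    fix z
    show "ennreal (f z) * indicator (\<Union>i. A i) z \<le> (\<Sum>i. ennreal (c i) * indicator (A i) z)"
    proof (cases "z \<in> (\<Union>i. A i)")
      case True
      then obtain j where j: "z \<in> A j" by blast
      have "ennreal (f z) \<le> ennreal (c j) * indicator (A j) z" using f[OF j] j by (simp add: ennreal_leI)
      also have "\<dots> = (\<Sum>i\<in>{j}. ennreal (c i) * indicator (A i) z)"
        by (subst sum.insert) (simp_all only: finite.emptyI empty_iff not_False_eq_True sum.empty add_0_right)
      also have "\<dots> \<le> (\<Sum>i. ennreal (c i) * indicator (A i) z)"
        by (intro sum_le_suminf summableI) simp_all
      finally show ?thesis using True by simp
    qed simp
  qed
  also have "\<dots> = (\<Sum>i. ennreal (c i) * emeasure M (A i))"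
    using A by (subst nn_integral_suminf) (simp_all add: nn_integral_cmult_indicator)
  also have "\<dots> \<le> (\<Sum>i. ennreal (c i * a i))"
    using a c a0 by (intro suminf_le summableI) (simp add: ennreal_mult mult_left_mono)
  also have "\<dots> = ennreal s"
    using s c a0 by (intro suminf_ennreal_eq) auto
  finally show ?thesis .
qed

text \<open>By Bernoulli's inequality the N-th power of the right side, N = n + 1, is at least 1/2.
  This turns the sum of a geometric series into a bound linear in \<open>n\<close>.\<close>

lemma half_root_le: "2 powr (- 1 / real (Suc n)) \<le> 1 - 1 / (2 * real (Suc n))"
proof -
  let ?N = "Suc n" and ?q = "2 powr (- 1 / real (Suc n)) :: real"
  have "?q ^ ?N = 2 powr (- 1 / real ?N * real ?N)"
    unfolding powr_powr[symmetric] by (rule powr_realpow[symmetric]) simp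
  also have "\<dots> = 1 / 2" by (simp add: powr_minus_divide del: of_nat_Suc)
  also have "\<dots> = 1 + real ?N * (- 1 / (2 * real ?N))" by (simp del: of_nat_Suc)
  also have "\<dots> \<le> (1 + - 1 / (2 * real ?N)) ^ ?N"
    by (intro Bernoulli_inequality) (simp add: divide_simps)
  finally have "?q ^ Suc n \<le> (1 - 1 / (2 * real ?N)) ^ Suc n" by (simp only: divide_minus_left add_uminus_conv_diff)
  then show ?thesis by (rule power_le_imp_le_base) (simp add: divide_simps)
qed

text \<open>Cut the disk into dyadic annuli \<open>A k\<close> around 1. On \<open>A k\<close> the
  integrand is at most \<open>d k powr (e - 2)\<close> and the area at most
  \<open>4 * pi * (d k)\<^sup>2\<close>, so the contributions form a geometric series of ratio
  \<open>2 powr (- e)\<close>, and \<open>1 - 2 powr (- e)\<close> is at least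
  \<open>e / 2\<close>.\<close>

lemma nn_integral_qd_le: "(\<integral>\<^sup>+z. ennreal (cmod (qd n z)) \<partial>area) \<le> ennreal (8 * pi * real (Suc n))"
proof -
  define e where "e = 1 / real (Suc n)"
  define d :: "nat \<Rightarrow> real" where "d k = (1/2) ^ k" for k
  define A where "A k = {z \<in> \<Delta>. d k \<le> cmod (1 - z) \<and> cmod (1 - z) < 2 * d k}" for k
  have d0: "0 < d k" for k by (simp add: d_def)
  have e0: "0 < e" "e \<le> 1" by (auto simp: e_def)
  have Aeq: "A k = \<Delta> \<inter> (ball 1 (2 * d k) - ball 1 (d k))" for k
    by (auto simp: A_def dist_norm)
  have cover: "z \<in> (\<Union>k. A k)" if "z \<in> \<Delta>" for z
  proof -
    note w = disk_one_minus[OF that]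
    have ex: "\<exists>k. d k \<le> cmod (1 - z)"
      using real_arch_pow_inv[OF w(3), of "1/2"] by (auto simp: d_def intro: less_imp_le)
    \<comment> \<open>The least such \<open>k\<close> also gives the upper bound: the preceding
      index fails, and for \<open>k = 0\<close> the bound reads
      \<open>cmod (1 - z) < 2\<close>.\<close>
    define k where "k = (LEAST k. d k \<le> cmod (1 - z))"
    have 1: "d k \<le> cmod (1 - z)" unfolding k_def by (rule LeastI_ex[OF ex])
    have 2: "cmod (1 - z) < 2 * d k"
    proof (cases k)
      case 0 then show ?thesis using w by (simp add: d_def)
    next
      case (Suc j)
      then have "\<not> d j \<le> cmod (1 - z)" unfolding k_def by (intro not_less_Least) simp
      then show ?thesis by (simp add: Suc d_def)
    qed
    show ?thesis using 1 2 that by (auto simp: A_def)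
  qed
  define q where "q = 2 powr (- e)"
  have q: "q \<le> 1 - e / 2" using half_root_le[of n] by (simp add: q_def e_def mult.commute del: of_nat_Suc)
  have q0: "0 < q" by (simp add: q_def)
  have summand: "(d k) powr (e - 2) * (4 * pi * (d k)\<^sup>2) = 4 * pi * q ^ k" for k
  proof -
    have "(d k) powr (e - 2) = (d k) powr e / (d k)\<^sup>2" using d0[of k] by (simp add: powr_diff powr_numeral)
    moreover have "(d k) powr e = q ^ k"
    proof -
      have "d k = 2 powr (- real k)"
        by (simp add: d_def powr_minus powr_realpow power_one_over inverse_eq_divide)
      then have "(d k) powr e = 2 powr (- e * real k)" by (simp add: powr_powr mult.commute)
      also have "\<dots> = q powr real k" by (simp add: q_def powr_powr)
      finally show ?thesis using q0 by (simp add: powr_realpow)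
    qed
    ultimately show ?thesis using d0[of k] by simp
  qed
  have "(\<lambda>k. 4 * pi * q ^ k) sums (4 * pi * (1 / (1 - q)))"
    using q0 q e0 by (intro sums_mult geometric_sums) auto
  then have "(\<lambda>k. (d k) powr (e - 2) * (4 * pi * (d k)\<^sup>2)) sums (4 * pi * (1 / (1 - q)))"
    unfolding summand .
  moreover have "A k \<in> sets area" for k by (intro sets_area) (auto simp: Aeq)
  moreover have "emeasure area (A k) \<le> ennreal (4 * pi * (d k)\<^sup>2)" for k
  proof -
    have "emeasure area (A k) = emeasure lborel (A k)" by (rule emeasure_area) (auto simp: Aeq)
    also have "\<dots> \<le> emeasure lborel (ball (1::complex) (2 * d k))"
      by (intro emeasure_mono) (auto simp: Aeq)
    also have "\<dots> = ennreal (4 * pi * (d k)\<^sup>2)"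
      using d0[of k] by (subst emeasure_ball_complex) (auto simp: power_mult_distrib algebra_simps)
    finally show ?thesis .
  qed
  moreover have "cmod (qd n z) \<le> (d k) powr (e - 2)" if "z \<in> A k" for z k
    using that e0 d0[of k]
    by (subst norm_qd) (auto simp: A_def simp del: of_nat_Suc simp flip: e_def intro!: powr_mono2')
  ultimately have "(\<integral>\<^sup>+z. ennreal (cmod (qd n z)) * indicator (\<Union>k. A k) z \<partial>area) \<le> ennreal (4 * pi * (1 / (1 - q)))"
    by (intro nn_integral_UN_le[where a = "\<lambda>k. 4 * pi * (d k)\<^sup>2" and c = "\<lambda>k. d k powr (e - 2)"]) auto
  also have "4 * pi * (1 / (1 - q)) \<le> 4 * pi * (1 / (e / 2))"
    using q e0 by (intro mult_left_mono divide_left_mono mult_pos_pos) auto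
  also have "4 * pi * (1 / (e / 2)) = 8 * pi * real (Suc n)" by (simp add: e_def)
  also have "(\<integral>\<^sup>+z. ennreal (cmod (qd n z)) * indicator (\<Union>k. A k) z \<partial>area) = (\<integral>\<^sup>+z. ennreal (cmod (qd n z)) \<partial>area)"
    by (intro nn_integral_cong) (use cover in simp)
  finally show ?thesis by (simp add: ennreal_leI)
qed

text \<open>Disjoint disks of radius comparable to their distance from 1 carry equal weight.\<close>
lemma nn_integral_weight: "(\<integral>\<^sup>+z. ennreal (weight z) \<partial>area) = \<infinity>"
proof -
  define d :: "nat \<Rightarrow> real" where "d k = (1/2) ^ k" for k
  define B where "B k = ball (of_real (1 - d k) :: complex) (d k / 4)" for k
  have d: "0 < d k" "d k \<le> 1" for k by (auto simp: d_def power_le_one)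
  have sub: "B k \<subseteq> \<Delta>" for k
  proof
    fix z assume "z \<in> B k"
    then have "cmod (of_real (1 - d k) - z) < d k / 4" by (simp add: B_def dist_norm)
    moreover have "cmod z \<le> cmod (of_real (1 - d k)) + cmod (of_real (1 - d k) - z)"
      by (metis norm_minus_commute norm_triangle_sub)
    moreover have "cmod (of_real (1 - d k)) = 1 - d k" using d[of k] unfolding norm_of_real by simp
    ultimately show "z \<in> \<Delta>" using d[of k] by simp
  qed
  have wt: "16 / 25 / (d k)\<^sup>2 \<le> weight z" if "z \<in> B k" for z k
  proof -
    have "cmod (of_real (1 - d k) - z) < d k / 4" using that by (simp add: B_def dist_norm)
    moreover have "1 - z = of_real (d k) + (of_real (1 - d k) - z)" by simp
    then have "cmod (1 - z) \<le> cmod (of_real (d k)) + cmod (of_real (1 - d k) - z)"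
      by (metis norm_triangle_ineq)
    ultimately have "cmod (1 - z) \<le> 5 / 4 * d k" using d[of k] unfolding norm_of_real by simp
    then have "(cmod (1 - z))\<^sup>2 \<le> (5 / 4 * d k)\<^sup>2" by (intro power_mono) auto
    then have "1 / (5 / 4 * d k)\<^sup>2 \<le> weight z"
      unfolding weight_def using disk_one_minus[of z] that sub[of k] d[of k]
      by (intro divide_left_mono mult_pos_pos) auto
    then show ?thesis by (simp add: power_mult_distrib power_divide)
  qed
  have disj: "B i \<inter> B j = {}" if "i < j" for i j
  proof (rule ccontr)
    assume "B i \<inter> B j \<noteq> {}"
    then obtain z where z: "z \<in> B i" "z \<in> B j" by blast
    \<comment> \<open>The centres are at least \<open>d i / 2\<close> apart, while the radii add up
      to at most 3/8 of \<open>d i\<close>.\<close>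
    have "d j \<le> d (Suc i)" unfolding d_def using that by (intro power_decreasing) auto
    then have ij: "d j \<le> d i / 2" by (simp add: d_def)
    have "dist (of_real (1 - d i) :: complex) (of_real (1 - d j)) < d i / 4 + d j / 4"
      using z dist_triangle2[of "of_real (1 - d i) :: complex" "of_real (1 - d j)" z]
      by (simp add: B_def)
    also have "dist (of_real (1 - d i) :: complex) (of_real (1 - d j)) = \<bar>d j - d i\<bar>"
      unfolding dist_of_real by (simp add: dist_real_def)
    finally show False using ij d[of j] d[of i] by simp
  qed
  have dis: "disjoint_family B"
    unfolding disjoint_family_on_def by (metis disj Int_commute linorder_neqE_nat)
  have Bm: "B k \<in> sets area" for k by (intro sets_area sub) (auto simp: B_def)
  let ?M = "density area (\<lambda>z. ennreal (weight z))"
  have each: "ennreal (pi / 25) \<le> emeasure ?M (B k)" for k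
  proof -
    \<comment> \<open>Lower bound for the weight times the area of the disk; the scale
      \<open>d k\<close> cancels.\<close>
    have "ennreal (pi / 25) = ennreal (16 / 25 / (d k)\<^sup>2) * ennreal (pi * (d k / 4)\<^sup>2)"
      using d[of k] by (simp flip: ennreal_mult add: power_divide)
    also have "ennreal (pi * (d k / 4)\<^sup>2) = emeasure area (B k)"
      using d[of k] sub[of k] by (subst emeasure_area) (auto simp: B_def emeasure_ball_complex)
    also have "ennreal (16 / 25 / (d k)\<^sup>2) * emeasure area (B k) = (\<integral>\<^sup>+z. ennreal (16 / 25 / (d k)\<^sup>2) * indicator (B k) z \<partial>area)"
      using Bm by (simp add: nn_integral_cmult_indicator)
    also have "\<dots> \<le> (\<integral>\<^sup>+z. ennreal (weight z) * indicator (B k) z \<partial>area)"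
      using wt by (intro nn_integral_mono) (auto simp: indicator_def intro!: ennreal_leI)
    also have "\<dots> = emeasure ?M (B k)" using Bm by (simp add: emeasure_density)
    finally show ?thesis .
  qed
  have "ennreal (real m * (pi / 25)) \<le> (\<integral>\<^sup>+z. ennreal (weight z) \<partial>area)" for m
  proof -
    have "ennreal (real m * (pi / 25)) = (\<Sum>k<m. ennreal (pi / 25))"
      by (subst ennreal_mult) (simp_all add: ennreal_of_nat_eq_real_of_nat)
    also have "\<dots> \<le> (\<Sum>k<m. emeasure ?M (B k))" by (intro sum_mono each)
    also have "\<dots> = emeasure ?M (\<Union>k<m. B k)"
      using Bm dis by (intro sum_emeasure) (auto simp: disjoint_family_on_def)
    also have "\<dots> \<le> emeasure ?M (space ?M)" by (rule emeasure_space)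
    also have "\<dots> = (\<integral>\<^sup>+z. ennreal (weight z) * indicator (space area) z \<partial>area)"
      by (simp add: emeasure_density del: space_restrict_space space_lebesgue_on)
    also have "\<dots> = (\<integral>\<^sup>+z. ennreal (weight z) \<partial>area)"
      by (intro nn_integral_cong) simp
    finally show ?thesis .
  qed
  note le = this
  show ?thesis
  proof (rule ccontr)
    assume "(\<integral>\<^sup>+z. ennreal (weight z) \<partial>area) \<noteq> \<infinity>"
    then obtain r where r: "0 \<le> r" "(\<integral>\<^sup>+z. ennreal (weight z) \<partial>area) = ennreal r"
      by (cases "\<integral>\<^sup>+z. ennreal (weight z) \<partial>area") auto
    obtain m where "r / (pi / 25) < real m" using reals_Archimedean2 by blast
    then have "r < real m * (pi / 25)" by (simp add: pos_divide_less_eq)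
    then show False using le[of m] r by (simp add: ennreal_le_iff)
  qed
qed

subsection \<open>Extremality and non-decreasability\<close>

lemma BelI:
  assumes m: "\<nu> \<in> borel_measurable area" and B: "\<And>z. z \<in> \<Delta> \<Longrightarrow> cmod (\<nu> z) \<le> B" and B0: "0 \<le> B"
  shows "\<nu> \<in> Bel" "linf_norm \<nu> \<le> B"
proof -
  have m': "(\<lambda>z. ereal (cmod (\<nu> z))) \<in> borel_measurable area" using m by measurable
  have le: "esssup area (\<lambda>z. ereal (cmod (\<nu> z))) \<le> ereal B"
    using B by (intro esssup_I m' AE_I2) simp
  then have "esssup area (\<lambda>z. ereal (cmod (\<nu> z))) < \<infinity>" by (rule order.strict_trans1) simp
  then show "\<nu> \<in> Bel" using m by (simp add: Bel_def)
  \<comment> \<open>\<open>real_of_ereal\<close> sends \<open>-\<infinity>\<close> to 0; this case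
    is covered by \<open>0 \<le> B\<close>.\<close>
  show "linf_norm \<nu> \<le> B" using le B0 unfolding linf_norm_def
    by (cases "esssup area (\<lambda>z. ereal (cmod (\<nu> z)))") auto
qed

lemma Bel_measurable: "\<nu> \<in> Bel \<Longrightarrow> \<nu> \<in> borel_measurable area"
  by (simp add: Bel_def)

lemma AE_le_linf_norm:
  assumes "\<nu> \<in> Bel"
  shows "AE z in area. cmod (\<nu> z) \<le> linf_norm \<nu>"
proof -
  have "AE z in area. ereal (cmod (\<nu> z)) \<le> esssup area (\<lambda>z. ereal (cmod (\<nu> z)))"
    by (rule esssup_AE)
  moreover have "esssup area (\<lambda>z. ereal (cmod (\<nu> z))) < \<infinity>" using assms by (simp add: Bel_def)
  ultimately show ?thesis unfolding linf_norm_def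
    by (cases "esssup area (\<lambda>z. ereal (cmod (\<nu> z)))") auto
qed

lemma integrable_Bel_mult:
  fixes \<phi> :: "complex \<Rightarrow> complex"
  assumes \<nu>: "\<nu> \<in> Bel" and \<phi>: "integrable area \<phi>"
  shows "integrable area (\<lambda>z. \<nu> z * \<phi> z)"
proof (rule Bochner_Integration.integrable_bound)
  show "integrable area (\<lambda>z. linf_norm \<nu> *\<^sub>R \<phi> z)" using \<phi> by (rule integrable_scaleR_right)
  have [measurable]: "\<nu> \<in> borel_measurable area" "\<phi> \<in> borel_measurable area"
    using Bel_measurable[OF \<nu>] \<phi> by auto
  show "(\<lambda>z. \<nu> z * \<phi> z) \<in> borel_measurable area" by measurable
  from AE_le_linf_norm[OF \<nu>]
  show "AE z in area. cmod (\<nu> z * \<phi> z) \<le> cmod (linf_norm \<nu> *\<^sub>R \<phi> z)"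
  proof eventually_elim
    case (elim z)
    then have "cmod (\<nu> z) * cmod (\<phi> z) \<le> \<bar>linf_norm \<nu>\<bar> * cmod (\<phi> z)" by (intro mult_right_mono) auto
    then show ?case by (simp add: norm_mult)
  qed
qed

lemma integrable_Q: "\<phi> \<in> Q \<Longrightarrow> integrable area \<phi>"
  unfolding Q_def using holomorphic_measurable[of \<phi>] by (auto simp: integrable_norm_iff)

lemma zclassD:
  assumes "\<nu> \<in> zclass \<mu>" "\<mu> \<in> Bel" "\<phi> \<in> Q"
  shows "(LINT z|area. \<nu> z * \<phi> z) = (LINT z|area. \<mu> z * \<phi> z)"
proof -
  have "\<nu> \<in> Bel" and 0: "(LINT z|area. (\<mu> z - \<nu> z) * \<phi> z) = 0" using assms by (auto simp: zclass_def)
  note int = integrable_Bel_mult[OF _ integrable_Q[OF assms(3)]]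
  have "(LINT z|area. (\<mu> z - \<nu> z) * \<phi> z) = (LINT z|area. \<mu> z * \<phi> z) - (LINT z|area. \<nu> z * \<phi> z)"
    unfolding left_diff_distrib by (intro Bochner_Integration.integral_diff int assms \<open>\<nu> \<in> Bel\<close>)
  with 0 show ?thesis by simp
qed

lemma zclassI:
  assumes "\<nu> \<in> Bel" "\<mu> \<in> Bel" "\<And>\<phi>. \<phi> \<in> Q \<Longrightarrow> (LINT z|area. \<nu> z * \<phi> z) = (LINT z|area. \<mu> z * \<phi> z)"
  shows "\<nu> \<in> zclass \<mu>"
proof -
  have "(LINT z|area. (\<mu> z - \<nu> z) * \<phi> z) = 0" if "\<phi> \<in> Q" for \<phi>
  proof -
    note int = integrable_Bel_mult[OF _ integrable_Q[OF that]]
    have "(LINT z|area. (\<mu> z - \<nu> z) * \<phi> z) = (LINT z|area. \<mu> z * \<phi> z) - (LINT z|area. \<nu> z * \<phi> z)"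
      unfolding left_diff_distrib by (intro Bochner_Integration.integral_diff int assms)
    then show ?thesis using assms(3)[OF that] by simp
  qed
  then show ?thesis using assms by (auto simp: zclass_def)
qed

lemma zclass_sym_trans:
  assumes "\<mu> \<in> Bel" "\<nu> \<in> zclass \<mu>" "\<xi> \<in> zclass \<mu>"
  shows "\<xi> \<in> zclass \<nu>"
proof -
  have "\<nu> \<in> Bel" "\<xi> \<in> Bel" using assms by (auto simp: zclass_def)
  then show ?thesis using assms by (intro zclassI) (simp_all add: zclassD)
qed

section \<open>Lower bound for norms in a class\<close>

lemma qd_integrable: "integrable area (\<lambda>z. cmod (qd n z))"
  by (rule integrableI_bounded) (use nn_integral_qd_le[of n] in \<open>auto simp: less_top[symmetric] top_unique\<close>)

lemma qd_Q: "qd n \<in> Q"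
  using qd_holomorphic qd_integrable by (simp add: Q_def)

lemma integral_qd_le: "(LINT z|area. cmod (qd n z)) \<le> 8 * pi * real (Suc n)"
  using nn_integral_qd_le[of n] by (subst (asm) nn_integral_eq_integral[OF qd_integrable]) (auto simp: ennreal_le_iff)

lemma weight_conv: "z \<in> \<Delta> \<Longrightarrow> weight z = cmod (1 / (1 - z)\<^sup>2)"
  by (simp add: weight_def norm_divide norm_power)

text \<open>By Fatou's lemma a bound for all large \<open>n\<close> would pass to the pointwise
  limit, whose modulus \<open>weight\<close> has infinite integral.\<close>

lemma integral_qd_unbounded:
  assumes "\<And>n. n \<ge> n0 \<Longrightarrow> (LINT z|area. cmod (qd n z)) \<le> K"
  shows False
proof -
  have "(\<integral>\<^sup>+z. ennreal (weight z) \<partial>area) = (\<integral>\<^sup>+z. liminf (\<lambda>n. ennreal (cmod (qd (n + n0) z))) \<partial>area)"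
  proof (rule nn_integral_cong)
    fix z assume "z \<in> space area"
    then have z: "z \<in> \<Delta>" by simp
    have "(\<lambda>n. ennreal (cmod (qd (n + n0) z))) \<longlonglongrightarrow> ennreal (weight z)"
      unfolding weight_conv[OF z]
      by (intro tendsto_ennrealI tendsto_norm LIMSEQ_ignore_initial_segment qd_tendsto z)
    then show "ennreal (weight z) = liminf (\<lambda>n. ennreal (cmod (qd (n + n0) z)))"
      by (metis lim_imp_Liminf trivial_limit_sequentially)
  qed
  also have "\<dots> \<le> liminf (\<lambda>n. \<integral>\<^sup>+z. ennreal (cmod (qd (n + n0) z)) \<partial>area)"
    by (rule nn_integral_liminf) measurable
  also have "\<dots> \<le> liminf (\<lambda>n. ennreal K)"
    using assms by (intro Liminf_mono always_eventually allI)
      (subst nn_integral_eq_integral[OF qd_integrable], auto intro!: ennreal_leI)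
  also have "\<dots> = ennreal K" by (rule Liminf_const) simp
  finally show False using nn_integral_weight by (simp add: top_unique)
qed

text \<open>Pair with \<open>qd n\<close>, whose norms \<open>N n\<close> are unbounded, and take
  real parts. For \<open>direction\<close> the result is at least
  \<open>(1 - 2 / (real (Suc n))\<^sup>2) * N n\<close>; passing to \<open>\<nu>\<close> costs at
  most the constant \<open>C\<close>, passing on to \<open>\<nu>'\<close> costs nothing, and there
  it is at most \<open>linf_norm \<nu>' * N n\<close>. A norm below 1 would therefore bound
  \<open>N n\<close>.\<close>

lemma extremal_lower_bound:
  assumes \<nu>: "\<nu> \<in> Bel" and int: "integrable area (\<lambda>z. cmod (direction z - \<nu> z) * weight z)"
    and \<nu>': "\<nu>' \<in> zclass \<nu>"
  shows "1 \<le> linf_norm \<nu>'"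
proof (rule ccontr)
  define L where "L = linf_norm \<nu>'"
  define C where "C = 2 * (LINT z|area. cmod (direction z - \<nu> z) * weight z)"
  assume "\<not> 1 \<le> linf_norm \<nu>'"
  then have L: "L < 1" by (simp add: L_def)
  have B': "\<nu>' \<in> Bel" using \<nu>' by (simp add: zclass_def)
  have Bd: "direction \<in> Bel" using norm_direction by (intro BelI[where B = 1]) auto
  define N where "N n = (LINT z|area. cmod (qd n z))" for n
  have N0: "0 \<le> N n" for n by (simp add: N_def)
  have main: "(1 - 2 / (real (Suc n))\<^sup>2) * N n \<le> C + L * N n" for n
  proof -
    note iq = integrable_Q[OF qd_Q[of n]]
    note i1 = integrable_Bel_mult[OF Bd iq] and i2 = integrable_Bel_mult[OF \<nu> iq]
      and i3 = integrable_Bel_mult[OF B' iq]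
    have "(1 - 2 / (real (Suc n))\<^sup>2) * N n = (LINT z|area. (1 - 2 / (real (Suc n))\<^sup>2) * cmod (qd n z))"
      by (simp add: N_def)
    also have "\<dots> \<le> (LINT z|area. Re (direction z * qd n z))"
      by (intro integral_mono integrable_Re i1 integrable_mult_right qd_integrable Re_direction_qd) simp
    also have "\<dots> = (LINT z|area. Re ((direction z - \<nu> z) * qd n z)) + (LINT z|area. Re (\<nu> z * qd n z))"
      unfolding left_diff_distrib
      by (subst Bochner_Integration.integral_add[symmetric])
        (intro integrable_Re Bochner_Integration.integrable_diff i1 i2
          | simp only: minus_complex.sel diff_add_cancel)+
    also have "(LINT z|area. Re (\<nu> z * qd n z)) = (LINT z|area. Re (\<nu>' z * qd n z))"
      by (simp only: integral_Re[OF i2] integral_Re[OF i3] zclassD[OF \<nu>' \<nu> qd_Q])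
    also have "\<dots> \<le> (LINT z|area. L * cmod (qd n z))"
    proof (rule integral_mono_AE)
      show "integrable area (\<lambda>z. Re (\<nu>' z * qd n z))" by (rule integrable_Re[OF i3])
      show "integrable area (\<lambda>z. L * cmod (qd n z))" using qd_integrable by simp
      from AE_le_linf_norm[OF B'] show "AE z in area. Re (\<nu>' z * qd n z) \<le> L * cmod (qd n z)"
      proof eventually_elim
        case (elim z)
        have "Re (\<nu>' z * qd n z) \<le> cmod (\<nu>' z * qd n z)" by (rule complex_Re_le_cmod)
        also have "\<dots> = cmod (\<nu>' z) * cmod (qd n z)" by (rule norm_mult)
        also have "\<dots> \<le> L * cmod (qd n z)" using elim by (intro mult_right_mono) (auto simp: L_def)
        finally show ?case .
      qed
    qed
    also have "\<dots> = L * N n" by (simp add: N_def)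
    also have "(LINT z|area. Re ((direction z - \<nu> z) * qd n z)) \<le> (LINT z|area. 2 * (cmod (direction z - \<nu> z) * weight z))"
    proof (rule integral_mono)
      show "integrable area (\<lambda>z. Re ((direction z - \<nu> z) * qd n z))"
        unfolding left_diff_distrib by (intro integrable_Re Bochner_Integration.integrable_diff i1 i2)
      show "integrable area (\<lambda>z. 2 * (cmod (direction z - \<nu> z) * weight z))" using int by (rule integrable_mult_right)
      fix z assume "z \<in> space area"
      then have z: "z \<in> \<Delta>" by simp
      have "Re ((direction z - \<nu> z) * qd n z) \<le> cmod ((direction z - \<nu> z) * qd n z)" by (rule complex_Re_le_cmod)
      also have "\<dots> = cmod (direction z - \<nu> z) * cmod (qd n z)" by (rule norm_mult)
      also have "\<dots> \<le> cmod (direction z - \<nu> z) * (2 * weight z)" by (intro mult_left_mono norm_qd_le z) simp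
      finally show "Re ((direction z - \<nu> z) * qd n z) \<le> 2 * (cmod (direction z - \<nu> z) * weight z)" by simp
    qed
    also have "\<dots> = C" unfolding C_def by (rule integral_mult_right_zero)
    finally show ?thesis by simp
  qed
  \<comment> \<open>From \<open>n0\<close> on, the phase loss
    \<open>2 / (real (Suc n))\<^sup>2\<close> is at most half the gap \<open>1 - L\<close>, and the
    other half bounds \<open>N n\<close>.\<close>
  obtain n0 where n0: "4 / (1 - L) < real n0" using reals_Archimedean2 by blast
  show False
  proof (rule integral_qd_unbounded)
    fix n assume n: "n0 \<le> n"
    have "real n0 \<le> real (Suc n)" using n by simp
    also have "real (Suc n) \<le> (real (Suc n))\<^sup>2" by (rule self_le_power) auto
    finally have n': "4 / (1 - L) < (real (Suc n))\<^sup>2" using n0 by linarith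
    then have "4 < (real (Suc n))\<^sup>2 * (1 - L)" using L by (simp only: pos_divide_less_eq)
    then have "2 / (real (Suc n))\<^sup>2 \<le> (1 - L) / 2" by (subst pos_divide_le_eq) (auto simp: algebra_simps simp del: of_nat_Suc)
    then have "(1 + L) / 2 \<le> 1 - 2 / (real (Suc n))\<^sup>2" by (simp add: field_simps)
    then have "(1 + L) / 2 * N n \<le> (1 - 2 / (real (Suc n))\<^sup>2) * N n" by (rule mult_right_mono[OF _ N0])
    also note main[of n]
    finally have "(1 - L) / 2 * N n \<le> C" by (simp add: field_simps)
    then show "(LINT z|area. cmod (qd n z)) \<le> C / ((1 - L) / 2)"
      unfolding N_def[symmetric] using L by (subst pos_le_divide_eq) (auto simp: mult.commute)
  qed
qed

section \<open>Non-decreasability of nonnegative multiples of \<open>direction\<close>\<close>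

lemma cmod_eq_if_Re_ge:
  assumes "cmod w \<le> r" "r \<le> Re w"
  shows "w = of_real r"
proof -
  have "Re w \<le> cmod w" by (rule complex_Re_le_cmod)
  with assms have R: "Re w = r" "cmod w = r" by auto
  then have "(Im w)\<^sup>2 = 0" using cmod_power2[of w] by simp
  then show ?thesis using R by (simp add: complex_eq_iff)
qed

text \<open>Reich's argument: the quadratic differentials \<^term>\<open>qd n\<close> form a Hamilton-type sequence whose
  phase error is \<open>O(1 / n\<^sup>2)\<close> while their norms are only \<open>O(n)\<close>, so Fatou's lemma forces
  equality almost everywhere.\<close>
lemma non_decreasable_nonneg_times_direction:
  fixes h :: "complex \<Rightarrow> real"
  assumes h [measurable]: "h \<in> borel_measurable area" and h0: "\<And>z. 0 \<le> h z" and hB: "\<And>z. z \<in> \<Delta> \<Longrightarrow> h z \<le> B"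
  shows "non_decreasable (\<lambda>z. of_real (h z) * direction z)"
  unfolding non_decreasable_def
proof (intro ballI impI)
  let ?\<nu> = "\<lambda>z. of_real (h z) * direction z"
  fix \<xi> assume \<xi>: "\<xi> \<in> zclass ?\<nu>" and le: "AE z in area. cmod (\<xi> z) \<le> cmod (?\<nu> z)"
  have B0: "0 \<le> B" using h0[of 0] hB[of 0] by simp
  have \<nu>: "?\<nu> \<in> Bel"
    using h0 hB B0 by (intro BelI[where B = B]) (auto simp: norm_mult norm_direction)
  have Bx: "\<xi> \<in> Bel" using \<xi> by (simp add: zclass_def)
  have [measurable]: "\<xi> \<in> borel_measurable area" by (rule Bel_measurable[OF Bx])
  have leh: "AE z in area. cmod (\<xi> z) \<le> h z"
    using le AE_space by eventually_elim (use h0 in \<open>simp add: norm_mult norm_direction\<close>)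
  \<comment> \<open>\<open>F n\<close> is the deficit of the competitor \<open>\<xi>\<close> against
    the largest pairing that modulus \<open>h\<close> allows, hence nonnegative almost everywhere;
    \<open>G\<close> is its pointwise limit.\<close>
  define F where "F n z = h z * cmod (qd n z) - Re (\<xi> z * qd n z)" for n z
  define G where "G z = h z * weight z - Re (\<xi> z * (1 / (1 - z)\<^sup>2))" for z
  have hBel: "(\<lambda>z. of_real (h z) :: complex) \<in> Bel"
    using h0 hB B0 by (intro BelI[where B = B]) auto
  have ih: "integrable area (\<lambda>z. h z * cmod (qd n z))" for n
    using integrable_norm[OF integrable_Bel_mult[OF hBel integrable_Q[OF qd_Q[of n]]]] h0
    by (simp add: norm_mult)
  have iF: "integrable area (F n)" for n
    unfolding F_def by (intro Bochner_Integration.integrable_diff ih integrable_Re integrable_Bel_mult Bx integrable_Q qd_Q)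
  have F0: "AE z in area. 0 \<le> F n z" for n
    using leh
  proof eventually_elim
    case (elim z)
    have "Re (\<xi> z * qd n z) \<le> cmod (\<xi> z) * cmod (qd n z)"
      by (metis complex_Re_le_cmod norm_mult)
    also have "\<dots> \<le> h z * cmod (qd n z)" using elim by (intro mult_right_mono) auto
    finally show ?case by (simp add: F_def)
  qed
  \<comment> \<open>Equivalence replaces \<open>\<xi>\<close> by \<open>?\<nu>\<close> in the
    pairing. The phase error \<open>2 * B / (real (Suc n))\<^sup>2\<close> times the norm bound
    \<open>8 * pi * real (Suc n)\<close> then tends to 0.\<close>
  have Fint: "(LINT z|area. F n z) \<le> 16 * pi * B / real (Suc n)" for n
  proof -
    note iq = integrable_Q[OF qd_Q[of n]]
    note i1 = integrable_Bel_mult[OF \<nu> iq] and i2 = integrable_Bel_mult[OF Bx iq]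
    have "(LINT z|area. F n z) = (LINT z|area. h z * cmod (qd n z)) - (LINT z|area. Re (\<xi> z * qd n z))"
      unfolding F_def by (intro Bochner_Integration.integral_diff ih integrable_Re i2)
    also have "(LINT z|area. Re (\<xi> z * qd n z)) = (LINT z|area. Re (?\<nu> z * qd n z))"
      by (simp only: integral_Re[OF i1] integral_Re[OF i2] zclassD[OF \<xi> \<nu> qd_Q])
    also have "(LINT z|area. h z * cmod (qd n z)) - (LINT z|area. Re (?\<nu> z * qd n z))
      = (LINT z|area. h z * cmod (qd n z) - Re (?\<nu> z * qd n z))"
      by (intro Bochner_Integration.integral_diff[symmetric] ih integrable_Re i1)
    also have "\<dots> \<le> (LINT z|area. (2 * B / (real (Suc n))\<^sup>2) * cmod (qd n z))"
    proof (rule integral_mono)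
      show "integrable area (\<lambda>z. h z * cmod (qd n z) - Re (?\<nu> z * qd n z))"
        by (intro Bochner_Integration.integrable_diff ih integrable_Re i1)
      show "integrable area (\<lambda>z. (2 * B / (real (Suc n))\<^sup>2) * cmod (qd n z))"
        by (intro integrable_mult_right qd_integrable)
      fix z assume "z \<in> space area"
      then have z: "z \<in> \<Delta>" by simp
      have "h z * cmod (qd n z) - Re (?\<nu> z * qd n z) = h z * (cmod (qd n z) - Re (direction z * qd n z))"
        by (simp add: algebra_simps)
      also have "\<dots> \<le> h z * (2 / (real (Suc n))\<^sup>2 * cmod (qd n z))"
        using Re_direction_qd[OF z, of n] by (intro mult_left_mono h0) (simp add: left_diff_distrib del: of_nat_Suc)
      also have "\<dots> \<le> B * (2 / (real (Suc n))\<^sup>2 * cmod (qd n z))"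
        by (intro mult_right_mono hB z) simp
      finally show "h z * cmod (qd n z) - Re (?\<nu> z * qd n z) \<le> (2 * B / (real (Suc n))\<^sup>2) * cmod (qd n z)"
        by (simp add: mult_ac)
    qed
    also have "\<dots> = (2 * B / (real (Suc n))\<^sup>2) * (LINT z|area. cmod (qd n z))" by simp
    also have "\<dots> \<le> (2 * B / (real (Suc n))\<^sup>2) * (8 * pi * real (Suc n))"
      using B0 by (intro mult_left_mono integral_qd_le) simp
    also have "\<dots> = 16 * pi * B / real (Suc n)" by (simp add: power2_eq_square del: of_nat_Suc)
    finally show ?thesis .
  qed
  have "(\<integral>\<^sup>+z. ennreal (G z) \<partial>area) = (\<integral>\<^sup>+z. liminf (\<lambda>n. ennreal (F n z)) \<partial>area)"
  proof (rule nn_integral_cong)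
    fix z assume "z \<in> space area"
    then have z: "z \<in> \<Delta>" by simp
    have "(\<lambda>n. F n z) \<longlonglongrightarrow> G z"
      unfolding F_def G_def weight_conv[OF z] by (intro tendsto_intros qd_tendsto z)
    then have "(\<lambda>n. ennreal (F n z)) \<longlonglongrightarrow> ennreal (G z)" by (rule tendsto_ennrealI)
    then show "ennreal (G z) = liminf (\<lambda>n. ennreal (F n z))"
      by (metis lim_imp_Liminf trivial_limit_sequentially)
  qed
  also have "\<dots> \<le> liminf (\<lambda>n. \<integral>\<^sup>+z. ennreal (F n z) \<partial>area)"
    using iF by (intro nn_integral_liminf) auto
  also have "\<dots> \<le> liminf (\<lambda>n. ennreal (16 * pi * B / real (Suc n)))"
    using F0 Fint by (intro Liminf_mono always_eventually allI)
      (subst nn_integral_eq_integral[OF iF], auto intro!: ennreal_leI simp del: of_nat_Suc)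
  also have "\<dots> = 0"
  proof -
    have "(\<lambda>n. 16 * pi * B / real (Suc n)) \<longlonglongrightarrow> 0"
      by (intro LIMSEQ_Suc lim_const_over_n)
    then have "(\<lambda>n. ennreal (16 * pi * B / real (Suc n))) \<longlonglongrightarrow> ennreal 0" by (rule tendsto_ennrealI)
    from lim_imp_Liminf[OF trivial_limit_sequentially this] show ?thesis by simp
  qed
  finally have "(\<integral>\<^sup>+z. ennreal (G z) \<partial>area) = 0" by simp
  moreover have sq [measurable]: "(\<lambda>z. 1 / (1 - z)\<^sup>2) \<in> borel_measurable area"
    using disk_one_minus by (intro holomorphic_measurable holomorphic_intros) fastforce
  have "(\<lambda>z. ennreal (G z)) \<in> borel_measurable area" unfolding G_def by measurable
  ultimately have "AE z in area. ennreal (G z) = 0" by (simp add: nn_integral_0_iff_AE)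
  with leh AE_space show "AE z in area. \<xi> z = ?\<nu> z"
  proof eventually_elim
    case (elim z)
    then have z: "z \<in> \<Delta>" by simp
    note w = disk_one_minus[OF z]
    \<comment> \<open>A vanishing deficit is the equality case of Re w \<le> |w|, which fixes both
      the modulus and the phase of \<open>\<xi> z\<close>.\<close>
    have "\<xi> z * (1 / (1 - z)\<^sup>2) = of_real (h z * weight z)"
    proof (rule cmod_eq_if_Re_ge)
      have "0 \<le> weight z" by (simp add: weight_def)
      then show "cmod (\<xi> z * (1 / (1 - z)\<^sup>2)) \<le> h z * weight z"
        unfolding norm_mult weight_conv[OF z] using elim by (intro mult_right_mono) auto
      show "h z * weight z \<le> Re (\<xi> z * (1 / (1 - z)\<^sup>2))" using elim by (simp add: G_def ennreal_eq_0_iff)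
    qed
    then have "\<xi> z = of_real (h z * weight z) * (1 - z)\<^sup>2" using w by (simp add: field_simps)
    then show ?case by (simp add: weight_def direction_def)
  qed
qed

subsection \<open>The construction\<close>

lemma AE_area_point:
  assumes P: "AE z in area. P z" and S: "S \<in> sets area" "emeasure area S \<noteq> 0"
  shows "\<exists>z\<in>S. P z"
proof (rule ccontr)
  assume "\<not> (\<exists>z\<in>S. P z)"
  then have "AE z in area. z \<notin> S" using P by (auto elim: eventually_mono)
  moreover have "S = {z \<in> space area. \<not> z \<notin> S}" using sets.sets_into_space[OF S(1)] by auto
  ultimately show False using AE_iff_measurable[OF S(1), of "\<lambda>z. z \<notin> S"] S(2) by blast
qed

lemma AE_area_open_point:
  assumes P: "AE z in area. P z" and G: "open G" "G \<noteq> {}" "G \<subseteq> \<Delta>"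
  shows "\<exists>z\<in>G. P z"
proof (rule AE_area_point[OF P])
  show "G \<in> sets area" using G by (intro sets_area) auto
  obtain z where "z \<in> G" using G(2) by blast
  then obtain e where e: "0 < e" "ball z e \<subseteq> G" using openE[OF G(1)] by blast
  have "0 < ennreal (pi * e\<^sup>2)" using e by (simp add: ennreal_less_zero_iff)
  also have "\<dots> = emeasure lborel (ball z e)" using e by (simp add: emeasure_ball_complex)
  also have "\<dots> \<le> emeasure lborel G" using G e by (intro emeasure_mono) auto
  also have "\<dots> = emeasure area G" using G by (intro emeasure_area[symmetric]) auto
  finally show "emeasure area G \<noteq> 0" by simp
qed

text \<open>Elements of \<open>Bel\<close> are classes of functions equal almost everywhere, so
  infinitely many dilatations means infinitely many classes of \<open>ae_eq\<close>.\<close>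

lemma infinite_quotient_ae_eq:
  fixes f :: "nat \<Rightarrow> complex \<Rightarrow> complex"
  assumes "\<And>i. f i \<in> A" "A \<subseteq> Bel" and neq: "\<And>i j. AE z in area. f i z = f j z \<Longrightarrow> i = j"
  shows "infinite (A // ae_eq)"
proof -
  have inj: "inj (\<lambda>i. ae_eq `` {f i})"
  proof (rule injI)
    fix i j assume eq: "ae_eq `` {f i} = ae_eq `` {f j}"
    have "f j \<in> ae_eq `` {f j}" using assms(1)[of j] assms(2) by (auto simp: ae_eq_def)
    then have "f j \<in> ae_eq `` {f i}" by (simp only: eq)
    then show "i = j" by (intro neq) (simp add: ae_eq_def)
  qed
  have "range (\<lambda>i. ae_eq `` {f i}) \<subseteq> A // ae_eq"
    using assms(1) by (auto simp: quotient_def)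
  then show ?thesis using range_inj_infinite[OF inj] finite_subset by blast
qed

section \<open>A dense open set of radii carrying little weight\<close>

lemma emeasure_shell_interval:
  assumes "0 \<le> a" "a \<le> b"
  shows "emeasure area (shell {a<..<b}) \<le> ennreal (pi * (b\<^sup>2 - a\<^sup>2))"
proof -
  have sub: "shell {a<..<b} \<subseteq> ball 0 b - ball 0 a" by (auto simp: shell_def)
  have "emeasure area (shell {a<..<b}) = emeasure lborel (shell {a<..<b})"
    by (intro emeasure_area shell_borel) (auto simp: shell_def)
  also have "\<dots> \<le> emeasure lborel (ball 0 b - ball (0::complex) a)"
    by (intro emeasure_mono sub) simp
  also have "\<dots> = emeasure lborel (ball (0::complex) b) - emeasure lborel (ball (0::complex) a)"
    using emeasure_lborel_ball_finite[of "0::complex" a] assms by (intro emeasure_Diff) (auto intro: subset_ball)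
  also have "\<dots> = ennreal (pi * (b\<^sup>2 - a\<^sup>2))"
    using assms by (simp add: emeasure_ball_complex ennreal_minus right_diff_distrib)
  finally show ?thesis .
qed

text \<open>Thin annuli around the circles of rational radius; the annulus around radius \<open>q\<close> is thin
  compared with the square of the distance \<open>1 - q\<close> to the boundary.\<close>
lemma thin_dense_radii:
  "\<exists>E :: real set. open E \<and> (\<forall>a b. 0 \<le> a \<longrightarrow> a < b \<longrightarrow> b \<le> 1 \<longrightarrow> (\<exists>r\<in>E. a < r \<and> r < b)) \<and>
    (\<integral>\<^sup>+z. ennreal (weight z) * indicator (shell E) z \<partial>area) \<le> ennreal (pi / 32)"
proof -
  let ?R = "{0<..<1} \<inter> \<rat> :: real set"
  have "(1/2::real) \<in> ?R" by simp
  then have R: "?R \<noteq> {}" by blast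
  have cR: "countable ?R" by (intro countable_Int2 countable_rat)
  define q where "q = from_nat_into ?R"
  have rq: "range q = ?R" unfolding q_def by (rule range_from_nat_into[OF R cR])
  have q: "0 < q i" "q i < 1" for i using rangeI[of q i] unfolding rq by auto
  \<comment> \<open>The factor \<open>q i\<close> keeps the inner radius nonnegative,
    \<open>(1 - q i)\<^sup>2\<close> offsets the growth of the weight, the power of 1/2 makes the
    series converge, and 1024 brings its sum down to \<open>pi / 32\<close>.\<close>
  define e where "e i = q i * (1 - q i)\<^sup>2 / 1024 * (1/2) ^ i" for i
  have e0: "0 < e i" for i using q[of i] by (simp add: e_def)
  have ele: "e i \<le> q i * (1 - q i)\<^sup>2 / 1024" for i
    unfolding e_def using q[of i] by (intro mult_left_le) (auto simp: power_le_one)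
  have e1: "e i \<le> q i" for i
  proof -
    have "(1 - q i)\<^sup>2 \<le> 1" using q[of i] by (intro power_le_one) auto
    then have "q i * (1 - q i)\<^sup>2 \<le> q i" using q[of i] by (intro mult_left_le) auto
    then show ?thesis using ele[of i] q[of i] by linarith
  qed
  have e2: "e i \<le> (1 - q i) / 2" for i
  proof -
    have "(1 - q i)\<^sup>2 \<le> 1 - q i" using q[of i] by (simp add: power2_eq_square mult_left_le)
    moreover have "q i * (1 - q i)\<^sup>2 \<le> (1 - q i)\<^sup>2" using q[of i] by (intro mult_left_le_one_le) auto
    ultimately have "q i * (1 - q i)\<^sup>2 / 1024 \<le> (1 - q i) / 1024" by simp
    also have "\<dots> \<le> (1 - q i) / 2" using q[of i] by simp
    finally show ?thesis using ele[of i] by linarith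
  qed
  define I where "I i = {q i - e i <..< q i + e i}" for i
  define E where "E = (\<Union>i. I i)"
  have shellE: "shell E = (\<Union>i. shell (I i))" by (auto simp: shell_def E_def)
  have "(\<integral>\<^sup>+z. ennreal (weight z) * indicator (\<Union>i. shell (I i)) z \<partial>area) \<le> ennreal (pi / 32)"
  proof (rule nn_integral_UN_le)
    show "shell (I i) \<in> sets area" for i by (rule shell_measurable) (simp add: I_def)
    \<comment> \<open>Since \<open>e i\<close> is at most \<open>(1 - q i) / 2\<close>, the annulus
      keeps at least that distance from the unit circle and so from 1.\<close>
    show "weight z \<le> 4 / (1 - q i)\<^sup>2" if "z \<in> shell (I i)" for i z
    proof -
      have z: "z \<in> \<Delta>" "cmod z < q i + e i" using that by (auto simp: shell_def I_def)
      have "1 - cmod z \<le> cmod (1 - z)" using norm_triangle_ineq2[of 1 z] by simp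
      then have "(1 - q i) / 2 \<le> cmod (1 - z)" using z(2) e2[of i] by argo
      then have "((1 - q i) / 2)\<^sup>2 \<le> (cmod (1 - z))\<^sup>2" using q[of i] by (intro power_mono) auto
      then have "weight z \<le> 1 / ((1 - q i) / 2)\<^sup>2"
        unfolding weight_def using q[of i] disk_one_minus[OF z(1)] by (intro divide_left_mono mult_pos_pos) auto
      then show ?thesis by (simp add: power_divide)
    qed
    show "emeasure area (shell (I i)) \<le> ennreal (pi / 256 * (1 - q i)\<^sup>2 * (1/2) ^ i)" for i
    proof -
      have "emeasure area (shell (I i)) \<le> ennreal (pi * ((q i + e i)\<^sup>2 - (q i - e i)\<^sup>2))"
        unfolding I_def using e0[of i] e1[of i] by (intro emeasure_shell_interval) auto
      also have "pi * ((q i + e i)\<^sup>2 - (q i - e i)\<^sup>2) = pi * 4 * q i * e i"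
        by (simp add: power2_eq_square algebra_simps)
      also have "\<dots> = (q i)\<^sup>2 * (pi / 256 * (1 - q i)\<^sup>2 * (1/2) ^ i)"
        by (simp add: e_def power2_eq_square)
      also have "\<dots> \<le> pi / 256 * (1 - q i)\<^sup>2 * (1/2) ^ i"
        using q[of i] by (intro mult_left_le_one_le power_le_one) auto
      finally show ?thesis by (simp add: ennreal_leI)
    qed
    show "0 \<le> 4 / (1 - q i)\<^sup>2" for i by simp
    show "0 \<le> pi / 256 * (1 - q i)\<^sup>2 * (1/2) ^ i" for i by simp
    have eq: "4 / (1 - q i)\<^sup>2 * (pi / 256 * (1 - q i)\<^sup>2 * (1/2) ^ i) = pi / 64 * (1/2) ^ i" for i
      using q[of i] by simp
    have "(\<lambda>i. pi / 64 * (1/2) ^ i) sums (pi / 64 * (1 / (1 - 1/2)))"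
      by (intro sums_mult geometric_sums) simp
    then show "(\<lambda>i. 4 / (1 - q i)\<^sup>2 * (pi / 256 * (1 - q i)\<^sup>2 * (1/2) ^ i)) sums (pi / 32)"
      unfolding eq by simp
  qed
  then have "(\<integral>\<^sup>+z. ennreal (weight z) * indicator (shell E) z \<partial>area) \<le> ennreal (pi / 32)"
    unfolding shellE .
  moreover have "open E" unfolding E_def I_def by auto
  moreover have "\<exists>r\<in>E. a < r \<and> r < b" if ab: "0 \<le> a" "a < b" "b \<le> 1" for a b
  proof -
    obtain r where r: "r \<in> \<rat>" "a < r" "r < b" using Rats_dense_in_real[OF ab(2)] by blast
    then have "r \<in> range q" unfolding rq using ab by auto
    then obtain i where "r = q i" by blast
    then have "r \<in> I i" using e0[of i] by (simp add: I_def)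
    then have "r \<in> E" unfolding E_def by blast
    then show ?thesis using r by blast
  qed
  ultimately show ?thesis by blast
qed

lemma open_shell: "open S \<Longrightarrow> open (shell S)"
proof -
  assume "open S"
  then have "open (cmod -` S)" by (intro open_vimage continuous_intros)
  moreover have "shell S = \<Delta> \<inter> cmod -` S" by (auto simp: shell_def)
  ultimately show ?thesis by (simp add: open_Int)
qed

text \<open>Move a point of \<open>G\<close> slightly outwards along its ray until its modulus lies
  in \<open>E\<close>.\<close>

lemma shell_meets_open:
  assumes E: "\<And>a b. 0 \<le> a \<Longrightarrow> a < b \<Longrightarrow> b \<le> 1 \<Longrightarrow> \<exists>r\<in>E. a < r \<and> r < b"
    and G: "open G" "G \<subseteq> \<Delta>" "G \<noteq> {}"
  shows "G \<inter> shell E \<noteq> {}"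
proof -
  obtain z where z: "z \<in> G" using G(3) by blast
  then obtain e where e: "0 < e" "ball z e \<subseteq> G" using openE[OF G(1)] by blast
  have z1: "cmod z < 1" using z G(2) by auto
  \<comment> \<open>The direction of the ray; at 0, where \<open>sgn\<close> vanishes, the positive
    real axis is chosen.\<close>
  define u where "u = (if z = 0 then 1 else sgn z)"
  have u: "cmod u = 1" "z = of_real (cmod z) * u"
    by (simp_all add: u_def norm_sgn) (simp add: sgn_eq)
  obtain r where r: "r \<in> E" "cmod z < r" "r < min (cmod z + e) 1"
    using E[of "cmod z" "min (cmod z + e) 1"] z1 e by auto
  have r0: "0 \<le> r" using r(2) norm_ge_zero[of z] by linarith
  define y where "y = of_real r * u"
  have y: "cmod y = r" using r0 u by (simp add: y_def norm_mult)
  have "y - z = of_real (r - cmod z) * u" using u(2) by (simp add: y_def algebra_simps)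
  then have "cmod (y - z) = \<bar>r - cmod z\<bar>" using u(1) by (simp only: norm_mult norm_of_real) simp
  then have "y \<in> ball z e" using r by (simp add: dist_norm norm_minus_commute)
  then have "y \<in> G" using e by blast
  moreover have "y \<in> shell E" using y r G(2) \<open>y \<in> G\<close> by (auto simp: shell_def)
  ultimately show ?thesis by blast
qed

theorem theorem4:
  "\<exists>\<mu>\<in>Bel. \<mu> \<in> extremals \<mu> \<and>
     infinite ({\<nu> \<in> extremals \<mu>. non_decreasable \<nu>} // ae_eq) \<and>
     infinite ({\<nu> \<in> extremals \<mu>. pseudo_non_decreasable \<nu>} // ae_eq)"
proof -

  \<comment> \<open>The regions and their areas\<close>
  obtain E :: "real set" where E: "open E"
    "\<And>a b. 0 \<le> a \<Longrightarrow> a < b \<Longrightarrow> b \<le> 1 \<Longrightarrow> \<exists>r\<in>E. a < r \<and> r < b"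
    "(\<integral>\<^sup>+z. ennreal (weight z) * indicator (shell E) z \<partial>area) \<le> ennreal (pi / 32)"
    using thin_dense_radii by blast
  have Eb: "E \<in> sets borel" using E(1) by simp
  \<comment> \<open>\<open>A\<close>, \<open>B\<close> and \<open>C\<close> omit
    \<open>shell E\<close>, so that every \<open>\<nu> c\<close> below vanishes on this dense open
    set. \<open>D\<close> includes its part of \<open>shell E\<close>, which makes the transported
    mass visible there.\<close>
  define A where "A = shell ({..1/2} - E)"
  define B where "B = shell ({1/2<..3/4} - E)"
  define C where "C = shell ({3/4<..} - E)"
  define D where "D = shell {..1/2}"
  have meas [measurable]: "A \<in> sets area" "B \<in> sets area" "C \<in> sets area" "D \<in> sets area" "shell E \<in> sets area"
    unfolding A_def B_def C_def D_def using Eb by (intro shell_measurable sets.Diff; simp)+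
  have idm [measurable]: "(\<lambda>z. z) \<in> borel_measurable area"
    by (intro holomorphic_measurable holomorphic_on_ident)
  define m a where "m = measure area A" and "a = measure area D"

  have mono: "measure area S \<le> measure area T" if "S \<subseteq> T" "T \<in> sets area" for S T
    by (rule finite_measure.finite_measure_mono[OF finite_measure_area that])
  have disk: "measure area (shell {..r}) = pi * r\<^sup>2" if "0 \<le> r" "r < 1" for r
  proof -
    have "shell {..r} = cball 0 r" using that by (auto simp: shell_def)
    moreover have "emeasure area (cball 0 r) = emeasure lborel (cball (0::complex) r)"
      using that by (intro emeasure_area) auto
    ultimately show ?thesis using that by (simp add: measure_def emeasure_cball unit_ball_vol_2)
  qed
  \<comment> \<open>On the disk the weight is at least 1/4, so the area is at most four times
    \<open>pi / 32\<close>.\<close>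
  have thin: "measure area (shell E) \<le> pi / 8"
  proof -
    have "emeasure area (shell E) = (\<integral>\<^sup>+z. indicator (shell E) z \<partial>area)" by simp
    also have "\<dots> \<le> (\<integral>\<^sup>+z. ennreal 4 * (ennreal (weight z) * indicator (shell E) z) \<partial>area)"
    proof (intro nn_integral_mono)
      fix z assume "z \<in> space area"
      then have z: "z \<in> \<Delta>" by simp
      have "(cmod (1 - z))\<^sup>2 \<le> 2\<^sup>2" using disk_one_minus[OF z] by (intro power_mono) auto
      then have "1 \<le> 4 * weight z" using disk_one_minus[OF z] by (simp add: weight_def)
      then have "ennreal 1 \<le> ennreal (4 * weight z)" by (rule ennreal_leI)
      also have "ennreal (4 * weight z) = ennreal 4 * ennreal (weight z)"
        by (rule ennreal_mult) (simp_all add: weight_def)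
      finally have "1 \<le> ennreal 4 * ennreal (weight z)" by (simp only: ennreal_1)
      then show "indicator (shell E) z \<le> ennreal 4 * (ennreal (weight z) * indicator (shell E) z)"
        by (simp add: indicator_def)
    qed
    also have "\<dots> = ennreal 4 * (\<integral>\<^sup>+z. ennreal (weight z) * indicator (shell E) z \<partial>area)"
      by (intro nn_integral_cmult) measurable
    also have "\<dots> \<le> ennreal 4 * ennreal (pi / 32)" by (intro mult_left_mono E(3)) simp
    also have "\<dots> = ennreal (pi / 8)" by (subst ennreal_mult[symmetric]) simp_all
    finally show ?thesis unfolding measure_def by (intro enn2real_leI) simp_all
  qed
  \<comment> \<open>\<open>D\<close> has area \<open>pi / 4\<close>, more than
    \<open>shell E\<close> can remove.\<close>
  have mpos: "0 < m"
  proof -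
    have "measure area D \<le> measure area (A \<union> shell E)"
      by (intro mono sets.Un meas) (auto simp: A_def D_def shell_def)
    also have "\<dots> \<le> measure area A + measure area (shell E)"
      by (intro measure_Un_le) auto
    finally have "measure area D \<le> m + pi / 8" using thin unfolding m_def by linarith
    moreover have "measure area D = pi / 4" using disk[of "1/2"] by (simp add: D_def power2_eq_square)
    ultimately show ?thesis using pi_gt_zero by linarith
  qed
  \<comment> \<open>The annulus from 1/2 to 3/4 has area \<open>5 / 16 * pi\<close>, again more than
    \<open>pi / 8\<close>.\<close>
  have bpos: "emeasure area B \<noteq> 0"
  proof -
    have "measure area (shell {..3/4}) \<le> measure area ((B \<union> D) \<union> shell E)"
      by (intro mono sets.Un meas) (auto simp: B_def D_def shell_def)
    also have "\<dots> \<le> measure area (B \<union> D) + measure area (shell E)"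
      by (intro measure_Un_le) auto
    also have "measure area (B \<union> D) \<le> measure area B + measure area D"
      by (intro measure_Un_le) auto
    finally have "measure area (shell {..3/4}) \<le> measure area B + measure area D + pi / 8"
      using thin by linarith
    moreover have "measure area D = pi / 4" "measure area (shell {..3/4}) = 9 / 16 * pi"
      using disk[of "1/2"] disk[of "3/4"] by (simp_all add: D_def power2_eq_square)
    ultimately have "0 < measure area B" using pi_gt_zero by linarith
    then show ?thesis by (auto simp: measure_def)
  qed
  have ma: "m \<le> a" unfolding m_def a_def
    by (intro mono sets.Un meas) (auto simp: A_def D_def shell_def)
  then have apos: "0 < a" using mpos by simp

  \<comment> \<open>The mass \<open>m\<close> on \<open>A\<close> is moved in proportion \<open>t\<close> to the full disk \<open>D\<close>; \<open>B\<close> carries the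
    perturbation \<open>c z\<close>, and \<open>C\<close> produces extremality.\<close>
  define h where "h t z = ((1 - t) * indicat_real A z + t * (m / a) * indicat_real D z)
    * ((cmod (1 - z))\<^sup>2 / 16) + indicat_real C z" for t z
  define \<kappa> where "\<kappa> t z = of_real (h t z) * direction z" for t z
  define \<nu> where "\<nu> c z = \<kappa> 0 z + of_real c * (indicat_real B z *\<^sub>R z)" for c z
  let ?\<mu> = "\<kappa> 0"

  \<comment> \<open>Both families lie in \<open>Bel\<close> with norm at most 1\<close>
  have hm [measurable]: "h t \<in> borel_measurable area" for t
    unfolding h_def by measurable
  have AD: "A \<subseteq> D" and DC: "D \<inter> C = {}" and BA: "B \<inter> D = {}" and BC: "B \<inter> C = {}"
    by (auto simp: A_def B_def C_def D_def shell_def)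
  have h0: "0 \<le> h t z" if "0 \<le> t" "t \<le> 1" for t z
    using that mpos apos by (simp add: h_def)
  have h1: "h t z \<le> 1" if t: "0 \<le> t" "t \<le> 1" and z: "z \<in> \<Delta>" for t z
  proof (cases "z \<in> D")
    case True
    have "(cmod (1 - z))\<^sup>2 \<le> 2\<^sup>2" using disk_one_minus[OF z] by (intro power_mono) auto
    then have w: "(cmod (1 - z))\<^sup>2 / 16 \<le> 1" by simp
    \<comment> \<open>As \<open>m \<le> a\<close>, the radial density is at most
      \<open>(1 - t) + t\<close>, and the factor next to it is at most 1.\<close>
    have "t * (m / a) \<le> t" using t ma apos by (intro mult_left_le) auto
    moreover have "(1 - t) * indicat_real A z \<le> 1 - t" using t by (intro mult_left_le) (auto simp: indicator_def)
    ultimately have "(1 - t) * indicat_real A z + t * (m / a) * indicat_real D z \<le> 1" using True by simp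
    moreover have "0 \<le> (1 - t) * indicat_real A z + t * (m / a) * indicat_real D z"
      using t mpos apos by simp
    ultimately have "((1 - t) * indicat_real A z + t * (m / a) * indicat_real D z) * ((cmod (1 - z))\<^sup>2 / 16) \<le> 1 * 1"
      using w by (intro mult_mono) auto
    moreover have "z \<notin> C" using True DC by blast
    ultimately show ?thesis unfolding h_def by simp
  next
    case False
    then show ?thesis using AD by (auto simp: h_def indicator_def)
  qed
  have \<kappa>B: "\<kappa> t \<in> Bel" "linf_norm (\<kappa> t) \<le> 1" if t: "0 \<le> t" "t \<le> 1" for t
  proof -
    have m: "\<kappa> t \<in> borel_measurable area" unfolding \<kappa>_def by measurable
    have b: "cmod (\<kappa> t z) \<le> 1" if z: "z \<in> \<Delta>" for z
      using h0[OF t, of z] h1[OF t z] norm_direction[OF z] by (simp add: \<kappa>_def norm_mult)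
    show "\<kappa> t \<in> Bel" "linf_norm (\<kappa> t) \<le> 1" using BelI[OF m b] by auto
  qed
  \<comment> \<open>Because \<open>\<kappa> 0\<close> vanishes on \<open>B\<close>, adding a
    multiple of \<open>z\<close> there raises the modulus without leaving the unit bound.\<close>
  have offB: "\<kappa> 0 z = 0" if "z \<in> B" for z
  proof -
    have "z \<notin> A" "z \<notin> C" using that AD BA BC by blast+
    then show ?thesis by (simp add: \<kappa>_def h_def)
  qed
  have \<nu>B: "\<nu> c \<in> Bel" "linf_norm (\<nu> c) \<le> 1" if c: "0 \<le> c" "c \<le> 1" for c
  proof -
    have km: "\<kappa> 0 \<in> borel_measurable area" unfolding \<kappa>_def by measurable
    have m: "\<nu> c \<in> borel_measurable area" unfolding \<nu>_def using km by measurable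
    have b: "cmod (\<nu> c z) \<le> 1" if z: "z \<in> \<Delta>" for z
    proof (cases "z \<in> B")
      case True
      have "c * cmod z \<le> 1 * 1" using c z by (intro mult_mono) auto
      then show ?thesis using offB[OF True] True c by (simp add: \<nu>_def norm_mult)
    next
      case False
      then show ?thesis using h0[of 0 z] h1[of 0 z] norm_direction[OF z] z by (simp add: \<nu>_def \<kappa>_def norm_mult)
    qed
    show "\<nu> c \<in> Bel" "linf_norm (\<nu> c) \<le> 1" using BelI[OF m b] by auto
  qed

  \<comment> \<open>Both families lie in the class of \<open>\<kappa> 0\<close>\<close>
  have \<mu>: "?\<mu> \<in> Bel" by (rule \<kappa>B) auto
  have \<kappa>Z: "\<kappa> t \<in> zclass ?\<mu>" if t: "0 \<le> t" "t \<le> 1" for t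
  proof -
    have "(LINT z|area. (?\<mu> z - \<kappa> t z) * \<phi> z) = 0" if "\<phi> \<in> Q" for \<phi>
    proof -
      \<comment> \<open>On \<open>D\<close> the factor \<open>(cmod (1 - z))\<^sup>2\<close> in
        \<open>h\<close> turns \<open>direction z\<close> into \<open>(1 - z)\<^sup>2\<close>, which
        is holomorphic and can be absorbed into the test function; what remains is radial.\<close>
      define F where "F z = (1 - z)\<^sup>2 * \<phi> z" for z
      have F: "F holomorphic_on \<Delta>" using that unfolding F_def Q_def by (auto intro!: holomorphic_intros)
      have eq: "(?\<mu> z - \<kappa> t z) * \<phi> z
        = of_real (t / 16) * (indicat_real A z *\<^sub>R F z - of_real (m / a) * (indicat_real D z *\<^sub>R F z))" for z
      proof -
        have d: "of_real ((cmod (1 - z))\<^sup>2) * direction z = (1 - z)\<^sup>2" by (simp add: direction_def)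
        have "(?\<mu> z - \<kappa> t z) * \<phi> z = of_real (h 0 z - h t z) * direction z * \<phi> z"
          by (simp add: \<kappa>_def algebra_simps)
        also have "h 0 z - h t z = t / 16 * (indicat_real A z - m / a * indicat_real D z) * (cmod (1 - z))\<^sup>2"
          by (simp add: h_def field_simps)
        also have "of_real (t / 16 * (indicat_real A z - m / a * indicat_real D z) * (cmod (1 - z))\<^sup>2) * direction z * \<phi> z
          = of_real (t / 16 * (indicat_real A z - m / a * indicat_real D z)) * (of_real ((cmod (1 - z))\<^sup>2) * direction z) * \<phi> z"
          by simp
        also have "\<dots> = of_real (t / 16) * (indicat_real A z *\<^sub>R F z - of_real (m / a) * (indicat_real D z *\<^sub>R F z))"
          unfolding d F_def by (simp add: scaleR_conv_of_real algebra_simps)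
        finally show ?thesis .
      qed
      have iA: "integrable area (\<lambda>z. indicat_real A z *\<^sub>R F z)"
          "(LINT z|area. indicat_real A z *\<^sub>R F z) = m *\<^sub>R F 0"
        unfolding A_def m_def using Eb by (intro integral_shell_holomorphic[OF F, where a = "1/2"]; auto)+
      have iD: "integrable area (\<lambda>z. indicat_real D z *\<^sub>R F z)"
          "(LINT z|area. indicat_real D z *\<^sub>R F z) = a *\<^sub>R F 0"
        unfolding D_def a_def by (intro integral_shell_holomorphic[OF F, where a = "1/2"]; auto)+
      \<comment> \<open>By the mean value property the two terms are \<open>m * F 0\<close> and
        \<open>m / a * (a * F 0)\<close>.\<close>
      show ?thesis
        unfolding eq integral_mult_right_zero Bochner_Integration.integral_diff[OF iA(1) integrable_mult_right[OF iD(1)]]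
          iA(2) iD(2) using apos by (simp add: scaleR_conv_of_real)
    qed
    then show ?thesis using \<kappa>B[OF t] by (simp add: zclass_def)
  qed
  have \<nu>Z: "\<nu> c \<in> zclass ?\<mu>" if c: "0 \<le> c" "c \<le> 1" for c
  proof -
    have "(LINT z|area. (?\<mu> z - \<nu> c z) * \<phi> z) = 0" if "\<phi> \<in> Q" for \<phi>
    proof -
      \<comment> \<open>This function vanishes at 0, so its mean over the radial set
        \<open>B\<close> is 0.\<close>
      have F: "(\<lambda>z. z * \<phi> z) holomorphic_on \<Delta>" using that unfolding Q_def by (auto intro!: holomorphic_intros)
      have "(LINT z|area. indicat_real B z *\<^sub>R (z * \<phi> z)) = 0"
        unfolding B_def using Eb
        by (subst integral_shell_holomorphic(2)[OF F, where a = "3/4"]) auto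
      moreover have "(\<lambda>z. (?\<mu> z - \<nu> c z) * \<phi> z) = (\<lambda>z. - of_real c * (indicat_real B z *\<^sub>R (z * \<phi> z)))"
        by (simp add: \<nu>_def fun_eq_iff)
      ultimately show ?thesis by (simp only: integral_mult_right_zero) simp
    qed
    then show ?thesis using \<nu>B[OF c] by (simp add: zclass_def)
  qed

  \<comment> \<open>Extremality of \<open>\<kappa> 0\<close> and of the norm bound 1\<close>
  have lower: "1 \<le> linf_norm \<xi>" if "\<xi> \<in> zclass ?\<mu>" for \<xi>
  proof (rule extremal_lower_bound[OF \<mu> _ that])
    have iE: "integrable area (\<lambda>z. weight z * indicat_real (shell E) z)"
    proof (rule integrableI_bounded)
      have "(\<integral>\<^sup>+z. ennreal (norm (weight z * indicat_real (shell E) z)) \<partial>area)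
        = (\<integral>\<^sup>+z. ennreal (weight z) * indicator (shell E) z \<partial>area)"
        by (intro nn_integral_cong) (simp add: indicator_def weight_def)
      also have "\<dots> < \<infinity>" using E(3) by (rule order.strict_trans1) simp
      finally show "(\<integral>\<^sup>+z. ennreal (norm (weight z * indicat_real (shell E) z)) \<partial>area) < \<infinity>" .
    qed measurable
    \<comment> \<open>Where \<open>cmod z \<le> 3/4\<close> the weight is at most 16 and the
      difference at most 2, which gives 32. On \<open>shell E\<close> the total weight is finite,
      and on \<open>C\<close> the two differentials coincide.\<close>
    show "integrable area (\<lambda>z. cmod (direction z - ?\<mu> z) * weight z)"
    proof (rule Bochner_Integration.integrable_bound)
      show "integrable area (\<lambda>z. 32 + 2 * (weight z * indicat_real (shell E) z))"
        by (intro Bochner_Integration.integrable_add integrable_mult_right iE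
            finite_measure.integrable_const[OF finite_measure_area])
      show "(\<lambda>z. cmod (direction z - ?\<mu> z) * weight z) \<in> borel_measurable area"
        unfolding \<kappa>_def by measurable
      have "cmod (direction z - ?\<mu> z) * weight z \<le> 32 + 2 * (weight z * indicat_real (shell E) z)"
        if z: "z \<in> \<Delta>" for z
      proof -
        have w0: "0 \<le> weight z" by (simp add: weight_def)
        have "cmod (direction z - ?\<mu> z) \<le> cmod (direction z) + cmod (?\<mu> z)" by (rule norm_triangle_ineq4)
        also have "\<dots> \<le> 2" using h0[of 0 z] h1[of 0 z] norm_direction[OF z] z by (simp add: \<kappa>_def norm_mult)
        finally have "cmod (direction z - ?\<mu> z) * weight z \<le> 2 * weight z" using w0 by (rule mult_right_mono)
        note le2 = this
        consider "cmod z \<le> 3/4" | "z \<in> shell E" | "z \<in> C"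
          using z by (force simp: C_def shell_def)
        then show ?thesis
        proof cases
          case 1
          have "1 - cmod z \<le> cmod (1 - z)" using norm_triangle_ineq2[of 1 z] by simp
          then have "1/4 \<le> cmod (1 - z)" using 1 by linarith
          then have "(1/4)\<^sup>2 \<le> (cmod (1 - z))\<^sup>2" by (intro power_mono) auto
          then have "weight z \<le> 1 / (1/4)\<^sup>2"
            unfolding weight_def using disk_one_minus[OF z] by (intro divide_left_mono mult_pos_pos) auto
          then have "2 * weight z \<le> 32" by (simp add: power2_eq_square)
          moreover have "0 \<le> 2 * (weight z * indicat_real (shell E) z)" using w0 by simp
          ultimately show ?thesis using le2 by linarith
        next
          case 2
          then show ?thesis using le2 by simp
        next
          case 3
          then have "z \<notin> A" using AD DC by blast
          then have "?\<mu> z = direction z" using 3 by (simp add: \<kappa>_def h_def)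
          then show ?thesis using w0 by simp
        qed
      qed
      then show "AE z in area. norm (cmod (direction z - ?\<mu> z) * weight z)
          \<le> norm (32 + 2 * (weight z * indicat_real (shell E) z))"
        by (intro AE_I2) (simp add: weight_def)
    qed
  qed
  have \<mu>Z: "?\<mu> \<in> zclass ?\<mu>" by (rule \<kappa>Z) auto
  have norm1: "zclass_norm ?\<mu> = 1"
  proof (rule antisym)
    have "bdd_below (linf_norm ` zclass ?\<mu>)" using lower by (intro bdd_belowI[of _ 1]) auto
    then have "zclass_norm ?\<mu> \<le> linf_norm ?\<mu>" unfolding zclass_norm_def using \<mu>Z by (intro cINF_lower)
    also have "\<dots> \<le> 1" by (rule \<kappa>B) auto
    finally show "zclass_norm ?\<mu> \<le> 1" .
    show "1 \<le> zclass_norm ?\<mu>" unfolding zclass_norm_def using \<mu>Z lower by (intro cINF_greatest) auto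
  qed
  have ext: "\<xi> \<in> extremals ?\<mu>" if "\<xi> \<in> zclass ?\<mu>" "linf_norm \<xi> \<le> 1" for \<xi>
    using that lower[OF that(1)] by (simp add: extremals_def norm1)
  have sub: "{\<xi> \<in> extremals ?\<mu>. P \<xi>} \<subseteq> Bel" for P by (auto simp: extremals_def zclass_def)

  \<comment> \<open>The non-decreasable family\<close>
  have t01: "0 \<le> 1 / real (Suc n)" "1 / real (Suc n) \<le> 1" "0 < 1 / real (Suc n)" for n by auto
  have nd: "infinite ({\<xi> \<in> extremals ?\<mu>. non_decreasable \<xi>} // ae_eq)"
  proof (rule infinite_quotient_ae_eq[where f = "\<lambda>n. \<kappa> (1 / real (Suc n))"])
    fix n
    let ?t = "1 / real (Suc n)"
    have "non_decreasable (\<lambda>z. of_real (h ?t z) * direction z)"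
      by (rule non_decreasable_nonneg_times_direction[where B = 1]) (use h0 h1 t01[of n] in auto)
    moreover have "\<kappa> ?t = (\<lambda>z. of_real (h ?t z) * direction z)" unfolding \<kappa>_def ..
    ultimately have "non_decreasable (\<kappa> ?t)" by (simp only:)
    moreover have "\<kappa> ?t \<in> extremals ?\<mu>" by (intro ext \<kappa>Z \<kappa>B t01)
    ultimately show "\<kappa> ?t \<in> {\<xi> \<in> extremals ?\<mu>. non_decreasable \<xi>}" by simp
  next
    fix i j
    let ?s = "1 / real (Suc i)" and ?t = "1 / real (Suc j)"
    assume eq: "AE z in area. \<kappa> ?s z = \<kappa> ?t z"
    \<comment> \<open>On \<open>shell E\<close> inside \<open>D\<close> only the transported mass is
      present: \<open>t\<close> times a positive factor independent of \<open>t\<close>. One point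
      there recovers \<open>t\<close>.\<close>
    have ne: "ball 0 (1/2) \<inter> shell E \<noteq> {}" by (rule shell_meets_open[OF E(2)]) auto
    have "\<exists>z\<in>ball 0 (1/2) \<inter> shell E. \<kappa> ?s z = \<kappa> ?t z"
      by (rule AE_area_open_point[OF eq _ ne]) (auto intro!: open_Int open_shell E(1))
    then obtain z where z: "cmod z < 1/2" "z \<in> shell E" "\<kappa> ?s z = \<kappa> ?t z" by auto
    have zD: "z \<in> \<Delta>" using z by simp
    have "z \<in> D" "z \<notin> A" "z \<notin> C" using z by (auto simp: A_def C_def D_def shell_def)
    then have hz: "h t z = t * (m / a) * ((cmod (1 - z))\<^sup>2 / 16)" for t by (simp add: h_def)
    have "direction z \<noteq> 0" using norm_direction[OF zD] by auto
    then have "h ?s z = h ?t z" using z(3) by (simp add: \<kappa>_def)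
    then have "?s = ?t" unfolding hz using mpos apos disk_one_minus[OF zD] by simp
    then show "i = j" by simp
  qed (rule sub)

  \<comment> \<open>The pseudo non-decreasable family\<close>
  have shellE0: "\<nu> c z = 0" if "z \<in> shell E" for c z
  proof -
    have "z \<notin> A" "z \<notin> B" "z \<notin> C" using that by (auto simp: A_def B_def C_def shell_def)
    then show ?thesis by (simp add: \<nu>_def \<kappa>_def h_def)
  qed
  have Bnz: "z \<noteq> 0" if "z \<in> B" for z using that by (auto simp: B_def shell_def)
  have pn: "infinite ({\<xi> \<in> extremals ?\<mu>. pseudo_non_decreasable \<xi>} // ae_eq)"
  proof (rule infinite_quotient_ae_eq[where f = "\<lambda>n. \<nu> (1 / real (Suc n))"])
    fix n
    let ?c = "1 / real (Suc n)"
    have "weakly_non_decreasable (\<nu> ?c)"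
      unfolding weakly_non_decreasable_def strongly_decreasable_def
    proof (clarify)
      fix \<xi> G and \<delta> :: real
      assume G: "open G" "G \<noteq> {}" "G \<subseteq> \<Delta>" and \<delta>: "0 < \<delta>"
        and le: "AE z in area. z \<in> G \<longrightarrow> cmod (\<xi> z) \<le> cmod (\<nu> ?c z) - \<delta>"
      \<comment> \<open>Every open \<open>G\<close> meets \<open>shell E\<close> in an open set,
        where \<open>\<nu> ?c\<close> is already 0 and cannot be lowered by
        \<open>\<delta>\<close>.\<close>
      have ne: "G \<inter> shell E \<noteq> {}" by (rule shell_meets_open[OF E(2) G(1,3,2)])
      have "\<exists>z\<in>G \<inter> shell E. z \<in> G \<longrightarrow> cmod (\<xi> z) \<le> cmod (\<nu> ?c z) - \<delta>"
        by (rule AE_area_open_point[OF le _ ne]) (use G in \<open>auto intro!: open_Int open_shell E(1)\<close>)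
      then obtain z where "z \<in> shell E" "cmod (\<xi> z) \<le> cmod (\<nu> ?c z) - \<delta>" by auto
      then have "cmod (\<xi> z) \<le> - \<delta>" by (simp add: shellE0)
      then show False using \<delta> norm_ge_zero[of "\<xi> z"] by linarith
    qed
    moreover have "\<not> non_decreasable (\<nu> ?c)"
    proof
      assume nd: "non_decreasable (\<nu> ?c)"
      \<comment> \<open>\<open>\<kappa> 0\<close> is the competitor: it agrees with
        \<open>\<nu> ?c\<close> off \<open>B\<close> and vanishes on \<open>B\<close>, a set of
        positive area where \<open>\<nu> ?c\<close> is a nonzero multiple of
        \<open>z\<close>.\<close>
      have "?\<mu> \<in> zclass (\<nu> ?c)" by (rule zclass_sym_trans[OF \<mu> \<nu>Z \<mu>Z]) (use t01[of n] in auto)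
      moreover have "AE z in area. cmod (?\<mu> z) \<le> cmod (\<nu> ?c z)"
      proof (rule AE_I2)
        show "cmod (?\<mu> z) \<le> cmod (\<nu> ?c z)" for z
          using offB[of z] by (cases "z \<in> B") (simp_all add: \<nu>_def)
      qed
      ultimately have "AE z in area. ?\<mu> z = \<nu> ?c z" using nd unfolding non_decreasable_def by blast
      then obtain z where "z \<in> B" "?\<mu> z = \<nu> ?c z" using AE_area_point[OF _ meas(2) bpos] by blast
      then show False using Bnz[of z] by (simp add: \<nu>_def del: of_nat_Suc)
    qed
    moreover have "\<nu> ?c \<in> extremals ?\<mu>" by (intro ext \<nu>Z \<nu>B t01)
    ultimately show "\<nu> ?c \<in> {\<xi> \<in> extremals ?\<mu>. pseudo_non_decreasable \<xi>}"
      by (simp add: pseudo_non_decreasable_def)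
  next
    fix i j
    assume eq: "AE z in area. \<nu> (1 / real (Suc i)) z = \<nu> (1 / real (Suc j)) z"
    obtain z where z: "z \<in> B" "\<nu> (1 / real (Suc i)) z = \<nu> (1 / real (Suc j)) z"
      using AE_area_point[OF eq meas(2) bpos] by blast
    then have "complex_of_real (1 / real (Suc i)) = of_real (1 / real (Suc j))"
      using Bnz[of z] unfolding \<nu>_def by simp
    then have "1 / real (Suc i) = 1 / real (Suc j)" unfolding of_real_eq_iff .
    then show "i = j" by simp
  qed (rule sub)
  show ?thesis
  proof (intro bexI[of _ ?\<mu>] conjI \<mu> nd pn)
    show "?\<mu> \<in> extremals ?\<mu>" by (intro ext \<mu>Z \<kappa>B) auto
  qed
qed

end
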